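(* Assume that the optimal control problem of minimizing $J(y,u)$ over the pairs $(y,u)\in L^2(0,T;\mathcal H)\times L^2(0,T;\mathcal H)$ solving the controlled equation with $y(0)=y_0$ admits an optimal controller $u^\ast$, with optimal trajectory $y^\ast=y(\cdot;u^\ast)$, where the cost functional $J$ satisfies the assumptions given in the context. Assume furthermore that there exists $\sigma>0$ such that the following (local) second-order sufficient optimality condition holds: $$J(y(\cdot;v),v)-J(y^\ast,u^\ast)\ \ge\ \sigma\,\|v-u^\ast\|^2_{L^2(0,T;\mathcal H)},$$ where $v\in L^2(0,T;\mathcal H)$ is chosen from some neighborhood $\mathcal U$ of $u^\ast$, and $y(\cdot;v)$ is the solution of the controlled equation with $v$ in place of $u$. Assume finally that the corresponding PM-based reduced optimal control problem (minimize $J_R(z,u_R)$ over the pairs $(z,u_R)\in L^2(0,T;\mathcal H^{\mathfrak c})\times L^2(0,T;\mathcal H^{\mathfrak c})$ solving the reduced system) admits an optimal controller $u_R^\ast$, which is furthermore contained in $\mathcal U$, and that the underlying PM function $h:\mathcal H^{\mathfrak c}\to\mathcal H^{\mathfrak s}_\alpha$ is locally Lipschitz. Then the suboptimal controller $u_R^\ast$ satisfies the error estimate $$\|u_R^\ast-u^\ast\|^2_{L^2(0,T;\mathcal H)}\le\frac{\mathcal C}{\sigma}\Bigl(\sqrt{Q(T,y_0;u_R^\ast)}\,\|y^\ast_{R,\mathfrak s}\|_{L^2(0,T;\mathcal H_\alpha)}+\sqrt{Q(T,y_0;u^\ast)}\,\|y^\ast_{\mathfrak s}\|_{L^2(0,T;\mathcal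 H_\alpha)}+\|\mathfrak C\|\,\|P_{\mathfrak s}u^\ast\|_{L^2(0,T;\mathcal H)}\Bigr),$$ where $Q(T,y_0;u_R^\ast)$ and $Q(T,y_0;u^\ast)$ are the parameterization defects of the finite-horizon PM function $h$ associated with the controllers $u_R^\ast$ and $u^\ast$; $y^\ast_{R,\mathfrak s}=P_{\mathfrak s}y_R^\ast$ and $y^\ast_{\mathfrak s}=P_{\mathfrak s}y^\ast$ are the high-mode projections of the suboptimal trajectory $y_R^\ast=y(\cdot;u_R^\ast)$ and of the optimal trajectory $y^\ast$, driven respectively by $\mathfrak Cu_R^\ast$ and $\mathfrak Cu^\ast$; and $\mathcal C$ is a positive constant depending in particular on $T$ and the local Lipschitz constant of $h$, given by $$\mathcal C=2C_\alpha\sqrt T\,\mathrm{Lip}(\mathcal G)|_V+2\max\{C(V),1\}\,T\,\mathrm{Lip}(\mathcal G)|_V\bigl(1+C_1C_\alpha\mathrm{Lip}(h)|_{V_{\mathfrak c}}\bigr)e^{[1+\beta_1(\lambda)+C_1C(V)(1+\mathrm{Lip}(h)|_{V_{\mathfrak c}})]T},$$ with the quantities entering $\mathcal C$ as defined in the context.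
   Context: Functional setting. $\mathcal H$ is a Hilbert space with norm $\|\cdot\|$; $\mathcal H_1$ is a subspace compactly and densely embedded in $\mathcal H$; $A:\mathcal H_1\to\mathcal H$ is a sectorial operator with $\mathrm{Re}(\sigma(-A))<0$; $\mathcal H_\alpha$ ($\alpha\in[0,1)$ fixed, norm $\|\cdot\|_\alpha$) is the interpolated space between $\mathcal H_1$ and $\mathcal H$. $L_\lambda=-A+B_\lambda$, where $B_\lambda:\mathcal H_\alpha\to\mathcal H$ is a bounded linear operator depending continuously on a real parameter $\lambda$, which is fixed. $L_\lambda$ is self-adjoint, with eigenvalues $\beta_1(\lambda)\ge\beta_2(\lambda)\ge\cdots$ and eigenvectors $e_i\in\mathcal H_\alpha$ forming a Hilbert basis of $\mathcal H$. $B:\mathcal H_\alpha\times\mathcal H_\alpha\to\mathcal H$ is a continuous bilinear map, $B(v):=B(v,v)$. $\mathfrak C:\mathcal H\to\mathcal H$ is a nonzero bounded linear operator. $T>0$ is fixed. Controlled equation. $\frac{dy}{dt}=L_\lambda y+B(y)+\mathfrak Cu(t)$ on $(0,T]$, $y(0)=y_0\in\mathcal H$. It is assumed that for any $y_0\in\mathcal H$, any $T>0$ and any $u\in L^2(0,T;\mathcal H)$ this Cauchy problem has a unique solution $y(\cdot,y_0;u)\in C([0,T];\mathcal H)\cap L^2(0,T;\mathcal H_\alpha)$, which lives furthermore in $C^1((0,T];\mathcal H)\cap C([0,T];\mathcal H_\alpha)\cap L^2(0,T;\mathcal H_1)$ when $y_0\in\mathcal H_\alpha$. For the fixed initial datum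 $y_0$, write $y(\cdot;u)=y(\cdot,y_0;u)$. Cost. $J(y,u)=\int_0^T[\mathcal G(y(t))+\mathcal E(u(t))]\,dt$, where $\mathcal G,\mathcal E:\mathcal H\to\mathbb R^+$ are continuous, $\mathcal G$ is uniformly Lipschitz on bounded sets of $\mathcal H$, and $\|u\|\le\|v\|$ implies $\mathcal E(u)\le\mathcal E(v)$. Low/high modes. $\mathcal H^{\mathfrak c}=\mathrm{span}\{e_1,\dots,e_m\}$; $\mathcal H^{\mathfrak s}$ and $\mathcal H^{\mathfrak s}_\alpha$ are its topological complements in $\mathcal H$ and $\mathcal H_\alpha$ (associated with the remaining modes); $P_{\mathfrak c},P_{\mathfrak s}$ are the canonical projectors onto $\mathcal H^{\mathfrak c},\mathcal H^{\mathfrak s}$; $L^{\mathfrak c}_\lambda=P_{\mathfrak c}L_\lambda$. It is assumed that $P_{\mathfrak c}\mathfrak CP_{\mathfrak c}\ne0$. PM function and defect. $h:\mathcal H^{\mathfrak c}\to\mathcal H^{\mathfrak s}_\alpha$ is a finite-horizon parameterizing manifold (PM) function over $[0,T]$ for the controlled equation: $h$ is continuous and, for given open sets $\mathcal V\subset\mathcal H_\alpha$ and $\mathcal U_{\mathrm{pm}}\subset L^2(0,T;\mathcal H)$, for all initial data $y_0\in\mathcal V$ and controls $u\in\mathcal U_{\mathrm{pm}}$, with $y_{\mathfrak c}=P_{\mathfrak c}y(\cdot,y_0;u)$ and $y_{\mathfrak s}=P_{\mathfrak s}y(\cdot,y_0;u)$, one has $\int_0^T\|y_{\mathfrak s}-h(y_{\mathfrak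 c})\|_\alpha^2dt<\int_0^T\|y_{\mathfrak s}\|_\alpha^2dt$. The parameterization defect, defined when $y_{\mathfrak s}(\cdot,y_0;u)$ is not identically zero, is $$Q(T,y_0;u)=\frac{\int_0^T\|y_{\mathfrak s}(t,y_0;u)-h(y_{\mathfrak c}(t,y_0;u))\|_\alpha^2dt}{\int_0^T\|y_{\mathfrak s}(t,y_0;u)\|_\alpha^2dt}.$$ Reduced problem. For $u_R\in L^2(0,T;\mathcal H^{\mathfrak c})$ the reduced system is $\frac{dz}{dt}=L^{\mathfrak c}_\lambda z+P_{\mathfrak c}B(z+h(z))+P_{\mathfrak c}\mathfrak Cu_R(t)$ on $(0,T]$, $z(0)=P_{\mathfrak c}y_0$; $h$ is assumed to be such that for any initial datum in $\mathcal H^{\mathfrak c}$ this system has a well-defined global $\mathcal H^{\mathfrak c}$-valued solution continuous in time. The reduced cost is $J_R(z,u_R)=\int_0^T[\mathcal G(z(t)+h(z(t)))+\mathcal E(u_R(t))]\,dt$. Constants. Let $z_R^\ast$ and $z^\ast$ be the solutions of the reduced system with controls $u_R^\ast$ and $P_{\mathfrak c}u^\ast$ respectively, $l_R=z_R^\ast+h(z_R^\ast)$, $l^\ast=z^\ast+h(z^\ast)$. $V\subset\mathcal H_\alpha$ is a bounded set containing $y_R^\ast(t),l_R(t),y^\ast(t),l^\ast(t)$ for all $t\in[0,T]$; $V_{\mathfrak c}=P_{\mathfrak c}V$. $\mathrm{Lip}(\mathcal G)|_V$ is the Lipschitz constant of $\mathcal G$ restricted to $V$; $\mathrm{Lip}(h)|_{V_{\mathfrak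 c}}$ is the Lipschitz constant of $h$ restricted to $V_{\mathfrak c}$ (in the norm $\|\cdot\|_\alpha$). $C_1>0$ satisfies $\|v\|_\alpha\le C_1\|v\|$ for $v\in\mathcal H^{\mathfrak c}$; $C_\alpha>0$ satisfies $\|v\|\le C_\alpha\|v\|_\alpha$ for $v\in\mathcal H_\alpha$; $C_B>0$ satisfies $\|B(v_1)-B(v_2)\|\le C_B(\|v_1\|_\alpha+\|v_2\|_\alpha)\|v_1-v_2\|_\alpha$ for $v_1,v_2\in\mathcal H_\alpha$; $C(V)>0$ is a constant such that $C_B(\|y_R^\ast(t)\|_\alpha+\|l_R(t)\|_\alpha)\le C(V)$ and $C_B(\|y^\ast(t)\|_\alpha+\|l^\ast(t)\|_\alpha)\le C(V)$ for all $t\in[0,T]$.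
   Formalization: C(V) is also taken so large that the bracket 1+β_1(λ)+C_1C(V)(1+Lip(h)) in the exponent is nonnegative (the estimate can fail otherwise); C^1((0,T];H) regularity of solutions is not assumed, and positivity of the constant C is not claimed (it is 0 if Lip(G)|_V=0). *)

theory Defs
  imports "HOL-Analysis.Analysis"
begin

section \<open>Subspaces of a Hilbert space carrying their own norm\<close>

definition normed_subspace :: "'a::real_vector set \<Rightarrow> ('a \<Rightarrow> real) \<Rightarrow> bool" where
  "normed_subspace X n \<longleftrightarrow> subspace X \<and>
     (\<forall>x\<in>X. n x = 0 \<longleftrightarrow> x = 0) \<and>
     (\<forall>x\<in>X. \<forall>y\<in>X. n (x + y) \<le> n x + n y) \<and>
     (\<forall>c. \<forall>x\<in>X. n (c *\<^sub>R x) = \<bar>c\<bar> * n x)"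

definition complete_in_norm :: "'a::real_vector set \<Rightarrow> ('a \<Rightarrow> real) \<Rightarrow> bool" where
  "complete_in_norm X n \<longleftrightarrow>
     (\<forall>s::nat \<Rightarrow> 'a. range s \<subseteq> X \<and> (\<forall>\<epsilon>>0. \<exists>N. \<forall>i\<ge>N. \<forall>j\<ge>N. n (s i - s j) < \<epsilon>) \<longrightarrow>
        (\<exists>l\<in>X. (\<lambda>k. n (s k - l)) \<longlonglongrightarrow> 0))"

definition compactly_densely_embedded :: "'a::real_normed_vector set \<Rightarrow> ('a \<Rightarrow> real) \<Rightarrow> bool" where
  "compactly_densely_embedded X n \<longleftrightarrow>
     compact (closure {x\<in>X. n x \<le> 1}) \<and> closure X = UNIV"

definition open_in_norm :: "('b::minus \<Rightarrow> real) \<Rightarrow> 'b set \<Rightarrow> 'b set \<Rightarrow> bool" where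
  "open_in_norm n X U \<longleftrightarrow>
     U \<subseteq> X \<and> (\<forall>u\<in>U. \<exists>r>0. \<forall>v\<in>X. n (v - u) < r \<longrightarrow> v \<in> U)"

definition continuous_in_norm ::
  "('a::minus \<Rightarrow> real) \<Rightarrow> 'b::topological_space set \<Rightarrow> ('b \<Rightarrow> 'a) \<Rightarrow> bool" where
  "continuous_in_norm n S f \<longleftrightarrow>
     (\<forall>x\<in>S. ((\<lambda>w. n (f w - f x)) \<longlongrightarrow> 0) (at x within S))"

definition lip_const ::
  "('a::minus \<Rightarrow> real) \<Rightarrow> ('b::minus \<Rightarrow> real) \<Rightarrow> 'a set \<Rightarrow> ('a \<Rightarrow> 'b) \<Rightarrow> real" where
  "lip_const n n' S f =
     Inf {K. 0 \<le> K \<and> (\<forall>x\<in>S. \<forall>y\<in>S. n' (f x - f y) \<le> K * n (x - y))}"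

definition locally_lipschitz_in_norm ::
  "('a::real_normed_vector \<Rightarrow> real) \<Rightarrow> 'a set \<Rightarrow> ('a \<Rightarrow> 'a) \<Rightarrow> bool" where
  "locally_lipschitz_in_norm n S f \<longleftrightarrow>
     (\<forall>x\<in>S. \<exists>r>0. \<exists>K. \<forall>a\<in>S \<inter> ball x r. \<forall>b\<in>S \<inter> ball x r.
        n (f a - f b) \<le> K * n (a - b))"

section \<open>Unbounded operators with domain \<open>D\<close>\<close>

definition linear_op_on :: "'a::real_vector set \<Rightarrow> ('a \<Rightarrow> 'b::real_vector) \<Rightarrow> bool" where
  "linear_op_on D f \<longleftrightarrow> subspace D \<and>
     (\<forall>x\<in>D. \<forall>y\<in>D. f (x + y) = f x + f y) \<and> (\<forall>c. \<forall>x\<in>D. f (c *\<^sub>R x) = c *\<^sub>R f x)"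

definition bounded_op_on ::
  "'a::real_vector set \<Rightarrow> ('a \<Rightarrow> real) \<Rightarrow> ('a \<Rightarrow> 'b::real_normed_vector) \<Rightarrow> bool" where
  "bounded_op_on X n f \<longleftrightarrow> linear_op_on X f \<and> (\<exists>K. \<forall>x\<in>X. norm (f x) \<le> K * n x)"

definition continuous_bilinear_on ::
  "'a::real_vector set \<Rightarrow> ('a \<Rightarrow> real) \<Rightarrow> ('a \<Rightarrow> 'a \<Rightarrow> 'b::real_normed_vector) \<Rightarrow> bool" where
  "continuous_bilinear_on X n f \<longleftrightarrow>
     (\<forall>x\<in>X. linear_op_on X (f x)) \<and> (\<forall>y\<in>X. linear_op_on X (\<lambda>x. f x y)) \<and>
     (\<exists>K. \<forall>x\<in>X. \<forall>y\<in>X. norm (f x y) \<le> K * n x * n y)"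

text \<open>
  The spectrum of a real operator is that of its complexification.  A pair \<open>(x, y)\<close> stands for
  \<open>x + \<i> y\<close>; the product norm is the norm of the complexified Hilbert space, and
  \<open>shifted \<zeta> A\<close> is \<open>\<zeta> - A\<close>.
\<close>

definition shifted :: "complex \<Rightarrow> ('a::real_vector \<Rightarrow> 'a) \<Rightarrow> 'a \<times> 'a \<Rightarrow> 'a \<times> 'a" where
  "shifted \<zeta> A p = (case p of (x, y) \<Rightarrow>
     (Re \<zeta> *\<^sub>R x - Im \<zeta> *\<^sub>R y - A x, Re \<zeta> *\<^sub>R y + Im \<zeta> *\<^sub>R x - A y))"

definition resolvent_set :: "'a::real_normed_vector set \<Rightarrow> ('a \<Rightarrow> 'a) \<Rightarrow> complex set" where
  "resolvent_set D A = {\<zeta>. bij_betw (shifted \<zeta> A) (D \<times> D) UNIV \<and>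
     (\<exists>K. \<forall>p\<in>D \<times> D. norm p \<le> K * norm (shifted \<zeta> A p))}"

definition spectrum_of :: "'a::real_normed_vector set \<Rightarrow> ('a \<Rightarrow> 'a) \<Rightarrow> complex set" where
  "spectrum_of D A = - resolvent_set D A"

text \<open>Sectorial operators in the sense of Henry.\<close>

definition sectorial :: "'a::real_normed_vector set \<Rightarrow> ('a \<Rightarrow> 'a) \<Rightarrow> bool" where
  "sectorial D A \<longleftrightarrow> linear_op_on D A \<and> closure D = UNIV \<and> closed ((\<lambda>x. (x, A x)) ` D) \<and>
     (\<exists>(a::real) (\<phi>::real) (M::real). 0 < \<phi> \<and> \<phi> < pi / 2 \<and> 1 \<le> M \<and>
        (\<forall>\<zeta>. \<zeta> \<noteq> of_real a \<and> \<phi> \<le> \<bar>Arg (\<zeta> - of_real a)\<bar> \<longrightarrow>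
           \<zeta> \<in> resolvent_set D A \<and>
           (\<forall>p\<in>D \<times> D. norm p \<le> M / cmod (\<zeta> - of_real a) * norm (shifted \<zeta> A p))))"

text \<open>The graph of the adjoint coincides with the graph of the (densely defined) operator.\<close>

definition self_adjoint_op :: "'a::real_inner set \<Rightarrow> ('a \<Rightarrow> 'a) \<Rightarrow> bool" where
  "self_adjoint_op D L \<longleftrightarrow> linear_op_on D L \<and> closure D = UNIV \<and>
     (\<forall>y z. (\<forall>x\<in>D. L x \<bullet> y = x \<bullet> z) \<longleftrightarrow> y \<in> D \<and> z = L y)"

section \<open>Interpolation between \<open>X\<close> (with norm \<open>n\<close>) and the ambient space\<close>

text \<open>
  The Hilbert interpolation space \<open>(H, X)\<^bsub>\<alpha>,2\<^esub>\<close> of Lions and Peetre, with \<open>H\<close> itself for \<open>\<alpha> = 0\<close>.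
  When \<open>X\<close> is the domain of a positive self-adjoint operator (in the controlled equation, of
  \<open>c - L\<close> for large \<open>c\<close>), this is the domain of its fractional power of order \<open>\<alpha>\<close>, with an
  equivalent norm.
\<close>

definition K_functional ::
  "'a::real_normed_vector set \<Rightarrow> ('a \<Rightarrow> real) \<Rightarrow> real \<Rightarrow> 'a \<Rightarrow> real" where
  "K_functional X n s v = Inf ((\<lambda>b. norm (v - b) + s * n b) ` X)"

definition interp_energy ::
  "real \<Rightarrow> 'a::real_normed_vector set \<Rightarrow> ('a \<Rightarrow> real) \<Rightarrow> 'a \<Rightarrow> ennreal" where
  "interp_energy \<alpha> X n v =
     (if \<alpha> = 0 then ennreal ((norm v)\<^sup>2)
      else \<integral>\<^sup>+s\<in>{0<..}. ennreal ((s powr (- \<alpha>) * K_functional X n s v)\<^sup>2 / s) \<partial>lborel)"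

text \<open>Only the equivalence class of the norm on the interpolation space is prescribed.\<close>

definition interpolated_space ::
  "real \<Rightarrow> 'a::real_normed_vector set \<Rightarrow> ('a \<Rightarrow> real) \<Rightarrow> 'a set \<Rightarrow> ('a \<Rightarrow> real) \<Rightarrow> bool" where
  "interpolated_space \<alpha> X n X\<alpha> n\<alpha> \<longleftrightarrow>
     X\<alpha> = {v. interp_energy \<alpha> X n v < \<infinity>} \<and> normed_subspace X\<alpha> n\<alpha> \<and>
     (\<exists>c>0. \<exists>C>0. \<forall>v\<in>X\<alpha>. c * sqrt (enn2real (interp_energy \<alpha> X n v)) \<le> n\<alpha> v \<and>
        n\<alpha> v \<le> C * sqrt (enn2real (interp_energy \<alpha> X n v)))"

section \<open>Spaces of square-integrable functions of time\<close>

text \<open>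
  Elements are functions rather than classes modulo null sets.  The target spaces are separable,
  so that in the ambient space Borel and strong measurability agree.
\<close>

definition L2_norm :: "('a \<Rightarrow> real) \<Rightarrow> real \<Rightarrow> (real \<Rightarrow> 'a) \<Rightarrow> real" where
  "L2_norm n T u = sqrt (LINT t|lebesgue_on {0..T}. (n (u t))\<^sup>2)"

definition L2 :: "real \<Rightarrow> (real \<Rightarrow> 'a::real_normed_vector) set" where
  "L2 T = {u. u \<in> borel_measurable (lebesgue_on {0..T}) \<and>
     integrable (lebesgue_on {0..T}) (\<lambda>t. (norm (u t))\<^sup>2)}"

text \<open>Square-integrable functions with values in \<open>X\<close>, Bochner measurable for the norm \<open>n\<close>.\<close>

definition L2_in :: "'a::minus set \<Rightarrow> ('a \<Rightarrow> real) \<Rightarrow> real \<Rightarrow> (real \<Rightarrow> 'a) set" where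
  "L2_in X n T = {u.
     (\<exists>s::nat \<Rightarrow> real \<Rightarrow> 'a.
        (\<forall>k. simple_function (lebesgue_on {0..T}) (s k) \<and> s k ` {0..T} \<subseteq> X) \<and>
        (AE t in lebesgue_on {0..T}. u t \<in> X \<and> (\<lambda>k. n (s k t - u t)) \<longlonglongrightarrow> 0)) \<and>
     integrable (lebesgue_on {0..T}) (\<lambda>t. (n (u t))\<^sup>2)}"

section \<open>Spectral modes; indices start at 1\<close>

definition hilbert_basis :: "(nat \<Rightarrow> 'a::real_inner) \<Rightarrow> bool" where
  "hilbert_basis e \<longleftrightarrow>
     (\<forall>i\<ge>1. \<forall>j\<ge>1. e i \<bullet> e j = (if i = j then 1 else 0)) \<and> closure (span (e ` {1..})) = UNIV"

definition low_modes :: "(nat \<Rightarrow> 'a::real_inner) \<Rightarrow> nat \<Rightarrow> 'a set" where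
  "low_modes e m = span (e ` {1..m})"

definition high_modes :: "(nat \<Rightarrow> 'a::real_inner) \<Rightarrow> nat \<Rightarrow> 'a set" where
  "high_modes e m = closure (span (e ` {m<..}))"

definition P_low :: "(nat \<Rightarrow> 'a::real_inner) \<Rightarrow> nat \<Rightarrow> 'a \<Rightarrow> 'a" where
  "P_low e m v = (\<Sum>i=1..m. (v \<bullet> e i) *\<^sub>R e i)"

definition P_high :: "(nat \<Rightarrow> 'a::real_inner) \<Rightarrow> nat \<Rightarrow> 'a \<Rightarrow> 'a" where
  "P_high e m v = v - P_low e m v"

section \<open>The controlled equation and its reduction\<close>

text \<open>
  For general initial data and merely square-integrable controls, a solution is a weak solution
  in the sense of Ball, which is the same as a mild solution.  Test vectors range over the domain
  of the adjoint of \<open>L\<close>; here \<open>L\<close> is self-adjoint, so this domain is \<open>D\<close> and the adjoint acts as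
  \<open>L\<close>.  If \<open>y\<close> is moreover square-integrable with values in \<open>D\<close>, the equation holds in the ambient
  space for almost every time.
\<close>

definition solves_controlled ::
  "'a::{real_inner,banach,second_countable_topology} set \<Rightarrow> ('a \<Rightarrow> 'a) \<Rightarrow>
   'a set \<Rightarrow> ('a \<Rightarrow> real) \<Rightarrow> ('a \<Rightarrow> 'a \<Rightarrow> 'a) \<Rightarrow> ('a \<Rightarrow>\<^sub>L 'a) \<Rightarrow>
   real \<Rightarrow> 'a \<Rightarrow> (real \<Rightarrow> 'a) \<Rightarrow> (real \<Rightarrow> 'a) \<Rightarrow> bool" where
  "solves_controlled D L X\<alpha> n\<alpha> B \<CC> T y0 u y \<longleftrightarrow>
     continuous_on {0..T} y \<and> y \<in> L2_in X\<alpha> n\<alpha> T \<and>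
     (\<forall>\<phi>\<in>D. \<forall>t\<in>{0..T}.
        integrable (lebesgue_on {0..t})
          (\<lambda>s. y s \<bullet> L \<phi> + (B (y s) (y s) + blinfun_apply \<CC> (u s)) \<bullet> \<phi>) \<and>
        y t \<bullet> \<phi> = y0 \<bullet> \<phi> + (LINT s|lebesgue_on {0..t}.
          y s \<bullet> L \<phi> + (B (y s) (y s) + blinfun_apply \<CC> (u s)) \<bullet> \<phi>))"

definition solves_reduced ::
  "(nat \<Rightarrow> 'a::{real_inner,banach,second_countable_topology}) \<Rightarrow> nat \<Rightarrow> ('a \<Rightarrow> 'a) \<Rightarrow>
   ('a \<Rightarrow> 'a \<Rightarrow> 'a) \<Rightarrow> ('a \<Rightarrow>\<^sub>L 'a) \<Rightarrow> ('a \<Rightarrow> 'a) \<Rightarrow>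
   real \<Rightarrow> 'a \<Rightarrow> (real \<Rightarrow> 'a) \<Rightarrow> (real \<Rightarrow> 'a) \<Rightarrow> bool" where
  "solves_reduced e m L B \<CC> h T z0 u z \<longleftrightarrow>
     continuous_on {0..T} z \<and> z ` {0..T} \<subseteq> low_modes e m \<and>
     (let F = (\<lambda>s. P_low e m (L (z s)) + P_low e m (B (z s + h (z s)) (z s + h (z s)))
                 + P_low e m (blinfun_apply \<CC> (u s)))
      in \<forall>t\<in>{0..T}. integrable (lebesgue_on {0..t}) F \<and>
           z t = z0 + (LINT s|lebesgue_on {0..t}. F s))"

text \<open>
  The running costs are nonnegative but need not be integrable along every control, so costs
  take values in the extended nonnegative reals.  The reduced cost of \<open>(z, u)\<close> is the cost of
  \<open>(\<lambda>t. z t + h (z t), u)\<close>.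
\<close>

definition cost :: "real \<Rightarrow> ('a \<Rightarrow> real) \<Rightarrow> ('a \<Rightarrow> real) \<Rightarrow> (real \<Rightarrow> 'a) \<Rightarrow> (real \<Rightarrow> 'a) \<Rightarrow> ennreal" where
  "cost T \<G> \<E> y u = (\<integral>\<^sup>+t. ennreal (\<G> (y t) + \<E> (u t)) \<partial>lebesgue_on {0..T})"

text \<open>Here \<open>sol y0 u y\<close> says that \<open>y\<close> solves the controlled equation from \<open>y0\<close> under \<open>u\<close>.\<close>

definition finite_horizon_PM ::
  "('a::{real_inner,banach,second_countable_topology} \<Rightarrow> (real \<Rightarrow> 'a) \<Rightarrow> (real \<Rightarrow> 'a) \<Rightarrow> bool) \<Rightarrow>
   'a set \<Rightarrow> ('a \<Rightarrow> real) \<Rightarrow> (nat \<Rightarrow> 'a) \<Rightarrow> nat \<Rightarrow> real \<Rightarrow>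
   'a set \<Rightarrow> (real \<Rightarrow> 'a) set \<Rightarrow> ('a \<Rightarrow> 'a) \<Rightarrow> bool" where
  "finite_horizon_PM sol X\<alpha> n\<alpha> e m T \<V> \<U> h \<longleftrightarrow>
     h ` low_modes e m \<subseteq> high_modes e m \<inter> X\<alpha> \<and>
     continuous_in_norm n\<alpha> (low_modes e m) h \<and>
     open_in_norm n\<alpha> X\<alpha> \<V> \<and> open_in_norm (L2_norm norm T) (L2 T) \<U> \<and>
     (\<forall>x0\<in>\<V>. \<forall>u\<in>\<U>. \<forall>y. sol x0 u y \<longrightarrow>
        (LINT t|lebesgue_on {0..T}. (n\<alpha> (P_high e m (y t) - h (P_low e m (y t))))\<^sup>2)
        < (LINT t|lebesgue_on {0..T}. (n\<alpha> (P_high e m (y t)))\<^sup>2))"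

definition param_defect ::
  "('a::real_inner \<Rightarrow> real) \<Rightarrow> (nat \<Rightarrow> 'a) \<Rightarrow> nat \<Rightarrow> ('a \<Rightarrow> 'a) \<Rightarrow> real \<Rightarrow> (real \<Rightarrow> 'a) \<Rightarrow> real" where
  "param_defect n\<alpha> e m h T y =
     (LINT t|lebesgue_on {0..T}. (n\<alpha> (P_high e m (y t) - h (P_low e m (y t))))\<^sup>2)
     / (LINT t|lebesgue_on {0..T}. (n\<alpha> (P_high e m (y t)))\<^sup>2)"

end

theory Submission
  imports Defs
begin

text \<open>
  By the second-order condition, \<open>\<sigma>\<close> times the squared distance of the controllers is at most
  \<open>J(y\<^sub>R, u\<^sub>R) - J(y, u)\<close> for the optimal pair \<open>(y, u)\<close>.  Since \<open>u\<^sub>R\<close> minimizes the reduced cost and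
  \<open>P\<^sub>c u\<close> is admissible for the reduced problem, this difference is at most
  \<open>(J(y\<^sub>R, u\<^sub>R) - J\<^sub>R(z\<^sub>R, u\<^sub>R)) + (J\<^sub>R(z, P\<^sub>c u) - J(y, u))\<close>, and each bracket is bounded by
  \<open>Lip(G)\<close> times the time integral of \<open>norm (z + h z - y)\<close>.  That norm is controlled by the defect
  \<open>P\<^sub>s y - h (P\<^sub>c y)\<close> and by \<open>w = z - P\<^sub>c y\<close>.  An energy estimate for \<open>w\<close>, in which two applications
  of Young's inequality produce the \<open>1\<close> in the exponent, and Gronwall's inequality bound \<open>w\<close> in
  turn by the defect and by \<open>P\<^sub>s u\<close>.
\<close>

section \<open>Norms on subspaces and Lipschitz constants\<close>

text \<open>Two norms are in play. Controls, costs and the continuity of solutions live in the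
  ambient norm, while the arguments of \<open>B\<close>, the values of \<open>h\<close> and the
  defect are measured in \<open>n\<close>. On the low modes the two are comparable through
  \<open>C1\<close> and \<open>C\<alpha>\<close>; elsewhere control in \<open>n\<close> comes from
  the \<open>n\<close>-bounded set \<open>V\<close>, which contains the trajectories and makes the
  defect bounded, hence integrable. Solutions are weak and controls merely square-integrable, so the
  equations are used only in integrated form. Testing with eigenvectors gives an integral equation
  for the low modes, and the energy estimate needs an integrated form of the derivative of the
  squared norm. The two gaps are not symmetric: \<open>uR\<close> drives both its reduced and its
  full trajectory, whereas \<open>P_low e m (ustar t)\<close> and \<open>ustar t\<close> differ by
  the high modes of the control. This is the origin of the last term of the estimate. Costs may be
  infinite, so they are compared in the extended reals, and the finite optimal cost is cancelled at
  the end. The argument yields half of the stated constant; the factor 2 is put in last.\<close>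

lemma lip_const_nonneg_and_bound:
  assumes K: "0 \<le> K" "\<And>x y. x \<in> S \<Longrightarrow> y \<in> S \<Longrightarrow> n' (f x - f y) \<le> K * n (x - y)"
    and nonneg: "\<And>x y. x \<in> S \<Longrightarrow> y \<in> S \<Longrightarrow> 0 \<le> n (x - y)"
  shows "0 \<le> lip_const n n' S f"
    and "x \<in> S \<Longrightarrow> y \<in> S \<Longrightarrow> n' (f x - f y) \<le> lip_const n n' S f * n (x - y)"
proof -
  let ?A = "{K. 0 \<le> K \<and> (\<forall>x\<in>S. \<forall>y\<in>S. n' (f x - f y) \<le> K * n (x - y))}"
  have ne: "?A \<noteq> {}"
    using K by blast
  show "0 \<le> lip_const n n' S f"
    unfolding lip_const_def by (rule cInf_greatest[OF ne]) auto
  assume xy: "x \<in> S" "y \<in> S"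
  show "n' (f x - f y) \<le> lip_const n n' S f * n (x - y)"
  \<comment> \<open>Every admissible constant dominates the difference quotient, hence so does their
    infimum. If \<open>n (x - y) = 0\<close> there is no quotient, and the constant \<open>K\<close>
    already gives the claim.\<close>
  proof (cases "n (x - y) = 0")
    case True
    then show ?thesis using K(2)[OF xy] by simp
  next
    case False
    then have pos: "0 < n (x - y)"
      using nonneg[OF xy] by simp
    have "n' (f x - f y) / n (x - y) \<le> Inf ?A"
      using xy pos by (intro cInf_greatest[OF ne]) (auto simp: pos_divide_le_eq)
    then show ?thesis
      using pos by (simp add: lip_const_def pos_divide_le_eq)
  qed
qed

lemma normed_subspaceD:
  assumes "normed_subspace X n"
  shows "subspace X" "x \<in> X \<Longrightarrow> n x = 0 \<longleftrightarrow> x = 0"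
    "x \<in> X \<Longrightarrow> y \<in> X \<Longrightarrow> n (x + y) \<le> n x + n y"
    "x \<in> X \<Longrightarrow> n (c *\<^sub>R x) = \<bar>c\<bar> * n x"
  using assms unfolding normed_subspace_def by blast+

lemma normed_subspace_minus:
  assumes "normed_subspace X n" "x \<in> X"
  shows "n (- x) = n x"
  using normed_subspaceD(4)[OF assms, of "-1"] by simp

text \<open>Nonnegativity is not built into \<open>normed_subspace\<close>; it follows from
  \<open>0 = n (x + - x) \<le> 2 * n x\<close>.\<close>

lemma normed_subspace_nonneg:
  assumes X: "normed_subspace X n" and x: "x \<in> X"
  shows "0 \<le> n x"
proof -
  have "- x \<in> X"
    using normed_subspaceD(1)[OF X] x by (rule subspace_neg)
  then have "n (x + - x) \<le> n x + n (- x)"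
    by (rule normed_subspaceD(3)[OF X x])
  moreover have "n 0 = 0"
    using normed_subspaceD(2)[OF X subspace_0[OF normed_subspaceD(1)[OF X]]] by simp
  ultimately show ?thesis
    using normed_subspace_minus[OF X x] by simp
qed

lemma normed_subspace_triangle_diff:
  assumes X: "normed_subspace X n" and "x \<in> X" "y \<in> X" "z \<in> X"
  shows "n (x - z) \<le> n (x - y) + n (y - z)"
  using normed_subspaceD(3)[OF X, of "x - y" "y - z"] normed_subspaceD(1)[OF X] assms
  by (simp add: subspace_diff)

lemma normed_subspace_diff_commute:
  assumes X: "normed_subspace X n" and "x \<in> X" "y \<in> X"
  shows "n (x - y) = n (y - x)"
  using normed_subspace_minus[OF X, of "x - y"] normed_subspaceD(1)[OF X] assms
  by (simp add: subspace_diff)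

lemma normed_subspace_abs_diff_le:
  assumes X: "normed_subspace X n" and "x \<in> X" "y \<in> X"
  shows "\<bar>n x - n y\<bar> \<le> n (x - y)"
proof -
  have "0 \<in> X"
    using normed_subspaceD(1)[OF X] by (rule subspace_0)
  then show ?thesis
    using normed_subspace_triangle_diff[OF X, of x y 0] normed_subspace_triangle_diff[OF X, of y x 0]
      normed_subspace_diff_commute[OF X, of x y] assms
    by simp
qed

text \<open>Compactness is used for pairs, in \<open>K \<times> K\<close>. Near a diagonal point the
  local Lipschitz condition applies directly; near a pair of distinct points
  \<open>n (f a - f b)\<close> is bounded above and \<open>n (a - b)\<close> is bounded away from 0.
  Balls and compactness refer to the ambient norm and the Lipschitz bounds to \<open>n\<close>, so
  \<open>embed\<close> and \<open>equiv\<close> are needed to pass between them.\<close>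

lemma locally_lipschitz_on_compact:
  fixes f :: "'a::real_normed_vector \<Rightarrow> 'a"
  assumes X: "normed_subspace X n" and S: "S \<subseteq> X" and f: "f ` S \<subseteq> X"
    and lip: "locally_lipschitz_in_norm n S f"
    and embed: "\<And>v. v \<in> X \<Longrightarrow> norm v \<le> C * n v"
    and equiv: "\<And>v w. v \<in> S \<Longrightarrow> w \<in> S \<Longrightarrow> n (v - w) \<le> C' * norm (v - w)"
    and K: "compact K" "K \<subseteq> S"
  shows "\<exists>M\<ge>0. \<forall>a\<in>K. \<forall>b\<in>K. n (f a - f b) \<le> M * n (a - b)"
proof -
  define P where "P M U \<longleftrightarrow> (\<forall>(a,b)\<in>U \<inter> K \<times> K. n (f a - f b) \<le> M * n (a - b))"
    for M and U :: "('a \<times> 'a) set"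
  have subX: "x - y \<in> X" if "x \<in> X" "y \<in> X" for x y
    using normed_subspaceD(1)[OF X] that by (rule subspace_diff)
  have nn: "0 \<le> n (a - b)" if "a \<in> K" "b \<in> K" for a b
    using normed_subspace_nonneg[OF X subX] that K S by blast
  have loc: "\<exists>U M. open U \<and> p \<in> U \<and> 0 \<le> M \<and> P M U" if p: "p \<in> K \<times> K" for p
  proof -
    obtain x y where xy: "p = (x, y)" "x \<in> K" "y \<in> K"
      using p by auto
    obtain r M where r: "r > 0"
      and M: "\<And>a b. a \<in> S \<inter> ball x r \<Longrightarrow> b \<in> S \<inter> ball x r \<Longrightarrow> n (f a - f b) \<le> M * n (a - b)"
      using lip xy K unfolding locally_lipschitz_in_norm_def by (meson subset_iff)
    obtain q N where q: "q > 0"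
      and N: "\<And>a b. a \<in> S \<inter> ball y q \<Longrightarrow> b \<in> S \<inter> ball y q \<Longrightarrow> n (f a - f b) \<le> N * n (a - b)"
      using lip xy K unfolding locally_lipschitz_in_norm_def by (meson subset_iff)
    show ?thesis
    proof (cases "x = y")
      case True
      have "P \<bar>M\<bar> (ball x r \<times> ball x r)"
        unfolding P_def
      proof clarify
        fix a b assume ab: "a \<in> ball x r" "b \<in> ball x r" "a \<in> K" "b \<in> K"
        then have "n (f a - f b) \<le> M * n (a - b)"
          using M K by blast
        also have "\<dots> \<le> \<bar>M\<bar> * n (a - b)"
          using nn[OF ab(3,4)] by (intro mult_right_mono) auto
        finally show "n (f a - f b) \<le> \<bar>M\<bar> * n (a - b)" .
      qed
      moreover have "open (ball x r \<times> ball x r)" "p \<in> ball x r \<times> ball x r"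
        using xy r True by (auto intro: open_Times)
      ultimately show ?thesis by (meson abs_ge_zero)
    next
      case False
      \<comment> \<open>With a third of the distance as radius, points of the two balls stay at
        least \<open>d\<close> apart, so \<open>\<bar>C\<bar> / d * n (a - b)\<close> is at least 1
        and may be inserted as a factor. \<open>W\<close> bounds \<open>n (f a - f b)\<close> by the
        detour through \<open>f x\<close> and \<open>f y\<close>. Absolute values appear because no
        sign is known for the constants.\<close>
      define d where "d = dist x y / 3"
      have d: "d > 0" using False by (simp add: d_def)
      define W where "W = \<bar>M\<bar> * (\<bar>C'\<bar> * r) + n (f x - f y) + \<bar>N\<bar> * (\<bar>C'\<bar> * q)"
      define Q where "Q = W * (\<bar>C\<bar> / d)"
      let ?U = "(ball x r \<inter> ball x d) \<times> (ball y q \<inter> ball y d)"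
      have fX: "f v \<in> X" if "v \<in> K" for v using f K that by blast
      have W0: "0 \<le> W"
        unfolding W_def using r q normed_subspace_nonneg[OF X subX[OF fX fX]] xy by simp
      have "P Q ?U"
        unfolding P_def
      proof clarify
        fix a b assume ab: "a \<in> ball x r" "a \<in> ball x d" "b \<in> ball y q" "b \<in> ball y d" "a \<in> K" "b \<in> K"
        have "n (f a - f x) \<le> M * n (a - x)"
          using ab xy K r by (intro M) auto
        also have "\<dots> \<le> \<bar>M\<bar> * (\<bar>C'\<bar> * r)"
        proof (intro mult_mono)
          have "n (a - x) \<le> C' * norm (a - x)"
            using equiv ab xy K by blast
          also have "\<dots> \<le> \<bar>C'\<bar> * r"
            using ab by (intro mult_mono) (auto simp: dist_norm norm_minus_commute)
          finally show "n (a - x) \<le> \<bar>C'\<bar> * r" .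
        qed (use nn ab xy in auto)
        finally have 1: "n (f a - f x) \<le> \<bar>M\<bar> * (\<bar>C'\<bar> * r)" .
        have "n (f y - f b) \<le> N * n (y - b)"
          using ab xy K q by (intro N) auto
        also have "\<dots> \<le> \<bar>N\<bar> * (\<bar>C'\<bar> * q)"
        proof (intro mult_mono)
          have "n (y - b) \<le> C' * norm (y - b)"
            using equiv ab xy K by blast
          also have "\<dots> \<le> \<bar>C'\<bar> * q"
            using ab by (intro mult_mono) (auto simp: dist_norm norm_minus_commute)
          finally show "n (y - b) \<le> \<bar>C'\<bar> * q" .
        qed (use nn ab xy in auto)
        finally have 2: "n (f y - f b) \<le> \<bar>N\<bar> * (\<bar>C'\<bar> * q)" .
        have "n (f a - f b) \<le> W"
          using normed_subspace_triangle_diff[OF X fX fX fX, of a x b]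
            normed_subspace_triangle_diff[OF X fX fX fX, of x y b] 1 2 ab xy
          unfolding W_def by simp
        moreover have "1 \<le> \<bar>C\<bar> / d * n (a - b)"
        proof -
          have "dist x y \<le> dist x a + dist a b + dist b y"
            by (smt (verit) dist_triangle)
          then have "d \<le> dist a b"
            using ab by (auto simp: d_def dist_commute)
          also have "\<dots> \<le> C * n (a - b)"
            unfolding dist_norm using ab K S by (intro embed subX) auto
          also have "\<dots> \<le> \<bar>C\<bar> * n (a - b)"
            using nn ab by (intro mult_right_mono) auto
          finally show ?thesis using d by (simp add: field_simps)
        qed
        then have "W * 1 \<le> W * (\<bar>C\<bar> / d * n (a - b))"
          by (rule mult_left_mono[OF _ W0])
        ultimately show "n (f a - f b) \<le> Q * n (a - b)"
          by (simp add: Q_def mult.assoc)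
      qed
      moreover have "open ?U" "p \<in> ?U"
        using xy r q d by (auto intro!: open_Times)
      moreover have "0 \<le> Q"
        using W0 d by (simp add: Q_def)
      ultimately show ?thesis by metis
    qed
  qed
  then obtain U M where UM: "\<And>p. p \<in> K \<times> K \<Longrightarrow> open (U p) \<and> p \<in> U p \<and> 0 \<le> M p \<and> P (M p) (U p)"
    by metis
  obtain F where F: "F \<subseteq> K \<times> K" "finite F" "K \<times> K \<subseteq> (\<Union>p\<in>F. U p)"
    using compactE_image[OF compact_Times[OF K(1) K(1)], of "K \<times> K" U] UM by (metis UN_I subsetI)
  show ?thesis
  proof (intro exI conjI ballI)
    \<comment> \<open>The sum of the finitely many nonnegative local constants replaces their
      maximum.\<close>
    show "0 \<le> (\<Sum>p\<in>F. M p)"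
      using UM F by (auto intro!: sum_nonneg)
    fix a b assume ab: "a \<in> K" "b \<in> K"
    then obtain p where p: "p \<in> F" "(a,b) \<in> U p"
      using F by blast
    have "n (f a - f b) \<le> M p * n (a - b)"
      using UM[of p] p F ab unfolding P_def by blast
    also have "\<dots> \<le> (\<Sum>p\<in>F. M p) * n (a - b)"
      using UM F p nn ab by (intro mult_right_mono member_le_sum) auto
    finally show "n (f a - f b) \<le> (\<Sum>p\<in>F. M p) * n (a - b)" .
  qed
qed

text \<open>Each further vector adds a compact segment in the sense of Minkowski sums, so linear
  independence plays no part. These boxes will enclose the low-mode projections of bounded
  sets.\<close>

lemma compact_bounded_combinations:
  fixes e :: "nat \<Rightarrow> 'a::real_normed_vector"
  shows "compact {(\<Sum>i=1..m. c i *\<^sub>R e i) |c. \<forall>i\<in>{1..m}. \<bar>c i\<bar> \<le> R}"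
proof (induction m)
  case 0
  then show ?case by simp
next
  case (Suc m)
  let ?S = "{(\<Sum>i=1..m. c i *\<^sub>R e i) |c. \<forall>i\<in>{1..m}. \<bar>c i\<bar> \<le> R}"
  let ?T = "(\<lambda>r. r *\<^sub>R e (Suc m)) ` {-R..R}"
  have "compact ?T"
    by (intro compact_continuous_image continuous_intros) auto
  then have "compact {x + y |x y. x \<in> ?S \<and> y \<in> ?T}"
    using Suc by (intro compact_sums)
  also have "{x + y |x y. x \<in> ?S \<and> y \<in> ?T} =
      {(\<Sum>i=1..Suc m. c i *\<^sub>R e i) |c. \<forall>i\<in>{1..Suc m}. \<bar>c i\<bar> \<le> R}" (is "?L = ?R")
  proof
    show "?L \<subseteq> ?R"
    proof clarify
      fix c r assume c: "\<forall>i\<in>{1..m}. \<bar>c i\<bar> \<le> R" and r: "r \<in> {-R..R}"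
      show "\<exists>d. (\<Sum>i=1..m. c i *\<^sub>R e i) + r *\<^sub>R e (Suc m) = (\<Sum>i=1..Suc m. d i *\<^sub>R e i) \<and>
          (\<forall>i\<in>{1..Suc m}. \<bar>d i\<bar> \<le> R)"
        using c r by (intro exI[of _ "c(Suc m := r)"]) (auto intro!: sum.cong)
    qed
    show "?R \<subseteq> ?L"
    proof clarify
      fix c assume c: "\<forall>i\<in>{1..Suc m}. \<bar>c i\<bar> \<le> R"
      show "\<exists>x y. (\<Sum>i=1..Suc m. c i *\<^sub>R e i) = x + y \<and> x \<in> ?S \<and> y \<in> ?T"
      proof (intro exI conjI)
        show "(\<Sum>i=1..m. c i *\<^sub>R e i) \<in> ?S" using c by fastforce
        show "c (Suc m) *\<^sub>R e (Suc m) \<in> ?T" using c by (auto simp: abs_le_iff minus_le_iff)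
      qed simp
    qed
  qed
  finally show ?case .
qed

section \<open>Integral identities and inequalities on an interval\<close>

lemma integrable_lebesgue_on_subset:
  fixes f :: "'a::euclidean_space \<Rightarrow> 'b::{banach,second_countable_topology}"
  assumes "integrable (lebesgue_on S) f" "A \<subseteq> S" "A \<in> sets lebesgue" "S \<in> sets lebesgue"
  shows "integrable (lebesgue_on A) f"
  using set_integrable_subset[of lebesgue S f A] assms
  by (simp add: set_integrable_def integrable_restrict_space)

lemma lebesgue_on_integral_diff:
  fixes g :: "real \<Rightarrow> 'a::{banach,second_countable_topology}"
  assumes g: "integrable (lebesgue_on {l..u}) g" and ab: "l \<le> a" "a \<le> b" "b \<le> u"
  shows "(LINT s|lebesgue_on {l..b}. g s) - (LINT s|lebesgue_on {l..a}. g s)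
    = (LINT s|lebesgue_on {a<..b}. g s)"
proof -
  have sub: "{l..a} \<subseteq> {l..u}" "{a<..b} \<subseteq> {l..u}"
    using ab by auto
  have "set_integrable lebesgue {l..a} g" "set_integrable lebesgue {a<..b} g"
    using integrable_lebesgue_on_subset[OF g sub(1)] integrable_lebesgue_on_subset[OF g sub(2)]
    by (simp_all add: set_integrable_def integrable_restrict_space)
  then have "(LINT s:{l..a} \<union> {a<..b}|lebesgue. g s) = (LINT s:{l..a}|lebesgue. g s) + (LINT s:{a<..b}|lebesgue. g s)"
    by (intro set_integral_Un) auto
  moreover have "{l..a} \<union> {a<..b} = {l..b}"
    using ab by auto
  ultimately show ?thesis
    by (simp add: set_lebesgue_integral_def integral_restrict_space)
qed

lemma lebesgue_on_singleton_integral: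
  fixes g :: "real \<Rightarrow> 'a::{banach,second_countable_topology}"
  shows "(LINT s|lebesgue_on {a..a}. g s) = 0"
  by (intro integral_eq_zero_null_sets) (auto simp: null_sets_restrict_space)

text \<open>Telescoping over an equal partition of mesh \<open>t / N < \<delta>\<close>: the bound
  is itself an increment, of \<open>G\<close>, so the bounds on the pieces add up exactly.\<close>

lemma increment_bound_of_small_increments:
  fixes D G :: "real \<Rightarrow> real"
  assumes "0 < \<delta>" "0 \<le> t"
    and small: "\<And>a b. 0 \<le> a \<Longrightarrow> a \<le> b \<Longrightarrow> b \<le> t \<Longrightarrow> b - a < \<delta> \<Longrightarrow> \<bar>D b - D a\<bar> \<le> G b - G a"
  shows "\<bar>D t - D 0\<bar> \<le> G t - G 0"
proof -
  obtain N :: nat where N: "t / \<delta> < real N"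
    using reals_Archimedean2 by blast
  then have N0: "0 < real N"
    using assms by (smt (verit) divide_nonneg_pos)
  define p where "p = t / N"
  have p: "p < \<delta>" "0 \<le> p" "real N * p = t"
    using N N0 \<open>0 < \<delta>\<close> \<open>0 \<le> t\<close> by (simp_all add: p_def field_simps)
  have "j \<le> N \<Longrightarrow> \<bar>D (real j * p) - D 0\<bar> \<le> G (real j * p) - G 0" for j
  proof (induction j)
    case 0
    then show ?case by simp
  next
    case (Suc j)
    have eq: "real (Suc j) * p = real j * p + p"
      by (simp add: algebra_simps)
    have "real (Suc j) * p \<le> real N * p"
      using Suc.prems p(2) by (intro mult_right_mono) simp_all
    then have le: "real j * p + p \<le> t"
      unfolding eq p(3) .
    have "0 \<le> real j * p"
      using p(2) by simp
    then have "\<bar>D (real j * p + p) - D (real j * p)\<bar> \<le> G (real j * p + p) - G (real j * p)"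
      using p(1,2) le by (intro small) simp_all
    moreover have "\<bar>D (real j * p) - D 0\<bar> \<le> G (real j * p) - G 0"
      using Suc by simp
    ultimately show ?case
      unfolding eq by linarith
  qed
  from this[of N] show ?thesis
    using p(3) by simp
qed

lemma integrable_continuous_inner:
  fixes w g :: "real \<Rightarrow> 'a::{real_inner,banach,second_countable_topology}"
  assumes w: "continuous_on {a..b} w" and g: "integrable (lebesgue_on {a..b}) g"
  shows "integrable (lebesgue_on {a..b}) (\<lambda>s. w s \<bullet> g s)"
proof -
  have "bounded (w ` {a..b})"
    using compact_continuous_image[OF w] by (auto intro: compact_imp_bounded)
  then obtain R where R: "\<And>s. s \<in> {a..b} \<Longrightarrow> norm (w s) \<le> R"
    by (metis bounded_iff imageI)
  have [measurable]: "w \<in> borel_measurable (lebesgue_on {a..b})"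
    using w by (rule continuous_imp_measurable_on_sets_lebesgue) simp
  have [measurable]: "g \<in> borel_measurable (lebesgue_on {a..b})"
    using g by (rule borel_measurable_integrable)
  show ?thesis
  proof (rule Bochner_Integration.integrable_bound)
    show "integrable (lebesgue_on {a..b}) (\<lambda>s. R * norm (g s))"
      using g by (intro integrable_mult_right integrable_norm)
    show "(\<lambda>s. w s \<bullet> g s) \<in> borel_measurable (lebesgue_on {a..b})"
      by measurable
    show "AE s in lebesgue_on {a..b}. norm (w s \<bullet> g s) \<le> norm (R * norm (g s))"
    proof (rule AE_I2)
      fix s assume "s \<in> space (lebesgue_on {a..b})"
      then have "norm (w s) \<le> R"
        using R by simp
      then have "norm (w s) * norm (g s) \<le> R * norm (g s)"
        by (rule mult_right_mono) simp
      then show "norm (w s \<bullet> g s) \<le> norm (R * norm (g s))"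
        using Cauchy_Schwarz_ineq2[of "w s" "g s"] by simp
    qed
  qed
qed

text \<open>
  Lebesgue differentiation is avoided: on an interval on which \<open>w\<close> oscillates by less than
  \<open>\<epsilon>\<close>, the increments of the two sides differ by at most \<open>2 * \<epsilon>\<close> times the integral of \<open>norm g\<close>.
\<close>

lemma inner_self_eq_integral:
  fixes w g :: "real \<Rightarrow> 'a::{real_inner,banach,second_countable_topology}"
  assumes cont: "continuous_on {0..t} w" and g: "integrable (lebesgue_on {0..t}) g"
    and w: "\<And>s. s \<in> {0..t} \<Longrightarrow> w s = (LINT r|lebesgue_on {0..s}. g r)" and t: "0 \<le> t"
  shows "w t \<bullet> w t = 2 * (LINT s|lebesgue_on {0..t}. w s \<bullet> g s)"
proof -
  define D where "D s = w s \<bullet> w s - 2 * (LINT r|lebesgue_on {0..s}. w r \<bullet> g r)" for s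
  define G where "G s = (LINT r|lebesgue_on {0..s}. norm (g r))" for s
  have wg: "integrable (lebesgue_on {0..t}) (\<lambda>s. w s \<bullet> g s)"
    using cont g by (rule integrable_continuous_inner)
  have ng: "integrable (lebesgue_on {0..t}) (\<lambda>s. norm (g s))"
    using g by simp
  have G0: "G 0 = 0" and D0: "D 0 = 0"
    using w[of 0] t by (simp_all add: G_def D_def lebesgue_on_singleton_integral del: atLeastAtMost_singleton)
  have est: "\<bar>D t\<bar> \<le> \<epsilon> * (2 * G t)" if \<epsilon>: "0 < \<epsilon>" for \<epsilon>
  proof -
    have "uniformly_continuous_on {0..t} w"
      using cont by (intro compact_uniformly_continuous) auto
    then obtain \<delta> where \<delta>: "\<delta> > 0"
      and osc: "\<And>a b. a \<in> {0..t} \<Longrightarrow> b \<in> {0..t} \<Longrightarrow> dist b a < \<delta> \<Longrightarrow> dist (w b) (w a) < \<epsilon>"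
      unfolding uniformly_continuous_on_def using \<epsilon> by metis
    have "\<bar>D t - D 0\<bar> \<le> 2 * \<epsilon> * G t - 2 * \<epsilon> * G 0"
    proof (rule increment_bound_of_small_increments[OF \<delta> t])
      fix a b :: real assume ab: "0 \<le> a" "a \<le> b" "b \<le> t" "b - a < \<delta>"
      let ?M = "lebesgue_on {a<..b}"
      have sub: "{a<..b} \<subseteq> {0..t}"
        using ab by auto
      have ig: "integrable ?M g" and iwg: "integrable ?M (\<lambda>s. w s \<bullet> g s)"
        using g wg sub by (auto intro: integrable_lebesgue_on_subset)
      \<comment> \<open>The difference of squares is factored so that \<open>w b + w a\<close>,
        constant in \<open>s\<close>, can be moved into the integral of \<open>g\<close> and
        compared there with \<open>2 * w s\<close>.\<close>
      have "D b - D a = (w b + w a) \<bullet> (w b - w a) - 2 * (LINT s|?M. w s \<bullet> g s)"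
        unfolding D_def lebesgue_on_integral_diff[OF wg ab(1-3), symmetric]
        by (simp add: algebra_simps inner_commute)
      also have "w b - w a = (LINT s|?M. g s)"
        using lebesgue_on_integral_diff[OF g ab(1-3)] w ab by simp
      also have "(w b + w a) \<bullet> (LINT s|?M. g s) = (LINT s|?M. (w b + w a) \<bullet> g s)"
        using ig by (rule integral_inner_right[symmetric])
      also have "\<dots> - 2 * (LINT s|?M. w s \<bullet> g s) = (LINT s|?M. (w b + w a) \<bullet> g s - 2 * (w s \<bullet> g s))"
        using ig iwg by (subst Bochner_Integration.integral_diff) auto
      finally have eq: "D b - D a = (LINT s|?M. (w b + w a) \<bullet> g s - 2 * (w s \<bullet> g s))" .
      have "\<bar>D b - D a\<bar> \<le> (LINT s|?M. norm ((w b + w a) \<bullet> g s - 2 * (w s \<bullet> g s)))"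
        unfolding eq real_norm_def[symmetric] by (rule integral_norm_bound)
      also have "\<dots> \<le> (LINT s|?M. 2 * \<epsilon> * norm (g s))"
      proof (rule integral_mono)
        fix s assume "s \<in> space ?M"
        then have s: "s \<in> {0..t}" "\<bar>b - s\<bar> < \<delta>" "\<bar>a - s\<bar> < \<delta>"
          using ab by auto
        have "norm ((w b + w a) \<bullet> g s - 2 * (w s \<bullet> g s)) = \<bar>((w b - w s) + (w a - w s)) \<bullet> g s\<bar>"
          by (simp add: algebra_simps)
        also have "\<dots> \<le> norm ((w b - w s) + (w a - w s)) * norm (g s)"
          by (rule Cauchy_Schwarz_ineq2)
        also have "\<dots> \<le> (2 * \<epsilon>) * norm (g s)"
        proof (intro mult_right_mono)
          have "norm (w b - w s) < \<epsilon>" "norm (w a - w s) < \<epsilon>"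
            using osc[of s b] osc[of s a] s ab by (auto simp: dist_norm)
          then show "norm ((w b - w s) + (w a - w s)) \<le> 2 * \<epsilon>"
            by (smt (verit) norm_triangle_ineq)
        qed simp
        finally show "norm ((w b + w a) \<bullet> g s - 2 * (w s \<bullet> g s)) \<le> 2 * \<epsilon> * norm (g s)" .
      qed (use ig iwg in auto)
      also have "\<dots> = 2 * \<epsilon> * G b - 2 * \<epsilon> * G a"
        using lebesgue_on_integral_diff[OF ng ab(1-3)] by (simp add: G_def algebra_simps flip: right_diff_distrib)
      finally show "\<bar>D b - D a\<bar> \<le> 2 * \<epsilon> * G b - 2 * \<epsilon> * G a" .
    qed
    then show ?thesis
      by (simp add: G0 D0 mult_ac)
  qed
  have "\<bar>D t\<bar> \<le> 0"
  proof (rule ccontr)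
    assume "\<not> \<bar>D t\<bar> \<le> 0"
    then have pos: "0 < \<bar>D t\<bar>" by simp
    have "0 \<le> G t" unfolding G_def by simp
    \<comment> \<open>This choice of \<open>\<epsilon>\<close> contradicts \<open>est\<close>,
      because \<open>2 * G t / (4 * G t + 1) < 1\<close>; the summand 1 covers the case
      \<open>G t = 0\<close>.\<close>
    then have "\<bar>D t\<bar> / (4 * G t + 1) * (2 * G t) < \<bar>D t\<bar>"
      using pos by (simp add: field_simps add_pos_nonneg)
    then show False
      using est[of "\<bar>D t\<bar> / (4 * G t + 1)"] pos \<open>0 \<le> G t\<close> by (simp add: divide_pos_pos)
  qed
  then show ?thesis
    by (simp add: D_def)
qed

lemma gronwall:
  fixes \<psi> :: "real \<Rightarrow> real"
  assumes cont: "continuous_on {0..T} \<psi>" and k: "0 \<le> k"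
    and bound: "\<And>t. t \<in> {0..T} \<Longrightarrow> \<psi> t \<le> F + k * (LINT s|lebesgue_on {0..t}. \<psi> s)"
    and t: "t \<in> {0..T}"
  shows "\<psi> t \<le> exp (k * t) * F"
proof -
  have LI: "(LINT s|lebesgue_on {0..r}. \<psi> s) = integral {0..r} \<psi>" if "r \<in> {0..T}" for r
    using that by (intro lebesgue_integral_eq_integral continuous_imp_integrable_real
      continuous_on_subset[OF cont]) auto
  have deriv: "((\<lambda>r. integral {0..r} \<psi>) has_real_derivative \<psi> r) (at r within {0..T})" if "r \<in> {0..T}" for r
    using integral_has_real_derivative[OF cont that] .
  \<comment> \<open>The integrating factor makes the derivative of \<open>v\<close> a nonnegative
    multiple of \<open>\<psi> r - (F + k * integral {0..r} \<psi>)\<close>, which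
    \<open>bound\<close> makes nonpositive.\<close>
  define v where "v r = exp (- k * r) * (F + k * integral {0..r} \<psi>)" for r
  have "v t \<le> v 0"
  proof (rule DERIV_nonpos_imp_decreasing_open[of 0 t])
    show "0 \<le> t" using t by simp
    have "continuous_on {0..T} (\<lambda>r. integral {0..r} \<psi>)"
      using deriv by (meson DERIV_continuous continuous_on_eq_continuous_within)
    then show "continuous_on {0..t} v"
      unfolding v_def using t by (intro continuous_intros) (auto elim: continuous_on_subset)
    fix r assume r: "0 < r" "r < t"
    then have "at r within {0..T} = at r"
      using t by (intro at_within_interior) auto
    then have "((\<lambda>r. integral {0..r} \<psi>) has_real_derivative \<psi> r) (at r)"
      using deriv[of r] r t by simp
    then have "(v has_real_derivative (exp (- k * r) * (k * (\<psi> r - (F + k * integral {0..r} \<psi>))))) (at r)"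
      unfolding v_def by (auto intro!: derivative_eq_intros simp: algebra_simps)
    moreover have "exp (- k * r) * (k * (\<psi> r - (F + k * integral {0..r} \<psi>))) \<le> 0"
      using bound[of r] LI[of r] r t k by (intro mult_nonneg_nonpos) auto
    ultimately show "\<exists>y. DERIV v r :> y \<and> y \<le> 0" by blast
  qed
  then have "F + k * integral {0..t} \<psi> \<le> exp (k * t) * F"
    by (simp add: v_def exp_minus field_simps)
  then show ?thesis
    using bound[OF t] LI[OF t] by simp
qed

text \<open>Cauchy-Schwarz against the constant 1, read off from the nonnegativity of the variance
  of \<open>f\<close> around its mean \<open>\<mu>\<close>.\<close>

lemma integral_le_sqrt_mult_sqrt_integral:
  assumes T: "0 < T" and f: "integrable (lebesgue_on {0..T}) f" "integrable (lebesgue_on {0..T}) (\<lambda>t. (f t)\<^sup>2)"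
  shows "(LINT t|lebesgue_on {0..T}. f t) \<le> sqrt T * sqrt (LINT t|lebesgue_on {0..T}. (f t)\<^sup>2)"
proof -
  let ?M = "lebesgue_on {0..T}"
  define \<mu> where "\<mu> = (LINT t|?M. f t) / T"
  interpret finite_measure ?M
    by (rule finite_measure_lebesgue_on) simp
  have "0 \<le> (LINT t|?M. (f t - \<mu>)\<^sup>2)"
    by simp
  also have "\<dots> = (LINT t|?M. (f t)\<^sup>2 - (2 * \<mu>) * f t + \<mu>\<^sup>2)"
    by (simp add: power2_diff algebra_simps)
  also have "\<dots> = (LINT t|?M. (f t)\<^sup>2) - 2 * \<mu> * (LINT t|?M. f t) + \<mu>\<^sup>2 * T"
    using f T by (simp add: measure_restrict_space)
  also have "\<dots> = (LINT t|?M. (f t)\<^sup>2) - (LINT t|?M. f t)\<^sup>2 / T"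
    using T by (simp add: \<mu>_def field_simps power2_eq_square)
  finally have "(LINT t|?M. f t)\<^sup>2 \<le> T * (LINT t|?M. (f t)\<^sup>2)"
    using T by (simp add: field_simps)
  then show ?thesis
    by (metis real_le_rsqrt real_sqrt_mult)
qed

text \<open>The norm \<open>n\<close> is not assumed to be Borel on the ambient space, so composing
  with the Borel function \<open>y\<close> would not do. Instead the simple functions that
  approximate \<open>y\<close> in \<open>n\<close> are composed with \<open>\<phi>\<close>, which
  must be sequentially continuous for \<open>n\<close>.\<close>

lemma borel_measurable_L2_in_compose:
  fixes \<phi> :: "'a::minus \<Rightarrow> real"
  assumes y: "y \<in> L2_in X n T" and yX: "\<And>t. t \<in> {0..T} \<Longrightarrow> y t \<in> X"
    and \<phi>: "\<And>s x. range s \<subseteq> X \<Longrightarrow> x \<in> X \<Longrightarrow> (\<lambda>k. n (s k - x)) \<longlonglongrightarrow> 0 \<Longrightarrow> (\<lambda>k::nat. \<phi> (s k)) \<longlonglongrightarrow> \<phi> x"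
  shows "(\<lambda>t. \<phi> (y t)) \<in> borel_measurable (lebesgue_on {0..T})"
proof -
  let ?M = "lebesgue_on {0..T}"
  obtain s :: "nat \<Rightarrow> real \<Rightarrow> 'a" where s: "\<And>k. simple_function ?M (s k)" "\<And>k. s k ` {0..T} \<subseteq> X"
    and lim: "AE t in ?M. y t \<in> X \<and> (\<lambda>k. n (s k t - y t)) \<longlonglongrightarrow> 0"
    using y unfolding L2_in_def by blast
  obtain N where N: "{t \<in> space ?M. \<not> (y t \<in> X \<and> (\<lambda>k. n (s k t - y t)) \<longlonglongrightarrow> 0)} \<subseteq> N"
    "emeasure ?M N = 0" "N \<in> sets ?M"
    using lim by (rule AE_E)
  \<comment> \<open>On the null set \<open>N\<close> nothing is known about convergence. The value 0
    there gives a genuine pointwise limit, and completeness of Lebesgue measure brings back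
    \<open>\<phi> (y t)\<close>.\<close>
  define f where "f t = (if t \<in> N then 0 else \<phi> (y t))" for t
  have "f \<in> borel_measurable ?M"
  proof (rule borel_measurable_LIMSEQ_real)
    fix k
    have [measurable]: "(\<lambda>t. \<phi> (s k t)) \<in> borel_measurable ?M"
      by (rule borel_measurable_simple_function[OF simple_function_compose1[OF s(1)]])
    show "(\<lambda>t. if t \<in> N then 0 else \<phi> (s k t)) \<in> borel_measurable ?M"
      using N(3) by measurable
  next
    fix t assume t: "t \<in> space ?M"
    show "(\<lambda>k. if t \<in> N then 0 else \<phi> (s k t)) \<longlonglongrightarrow> f t"
    proof (cases "t \<in> N")
      case False
      then have "(\<lambda>k. n (s k t - y t)) \<longlonglongrightarrow> 0" "y t \<in> X"
        using N(1) t by auto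
      moreover have "range (\<lambda>k. s k t) \<subseteq> X"
        using s(2) t by fastforce
      ultimately show ?thesis
        using False \<phi>[of "\<lambda>k. s k t" "y t"] by (simp add: f_def)
    qed (simp add: f_def)
  qed
  then have "(\<lambda>t. if t \<in> {0..T} then f t else 0) \<in> borel_measurable lebesgue"
    by (rule borel_measurable_if_I) simp
  moreover have "AE t in ?M. f t = \<phi> (y t)"
    using AE_not_in[of N ?M] N(2,3) by (auto simp: f_def null_sets_def)
  then have "AE t in lebesgue. (if t \<in> {0..T} then f t else 0) = (if t \<in> {0..T} then \<phi> (y t) else 0)"
    by (auto simp: AE_restrict_space_iff elim: eventually_mono)
  ultimately have "(\<lambda>t. if t \<in> {0..T} then \<phi> (y t) else 0) \<in> borel_measurable lebesgue"
    by (rule borel_measurable_AE)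
  then show ?thesis
    by (rule borel_measurable_if_D)
qed

text \<open>Measurability is asked of the right-hand integrands, where the integral of a sum is
  split; the left-hand one enters by monotonicity of the nonnegative integral.\<close>

lemma cost_le_cost_plus:
  assumes nonneg: "\<And>x. 0 \<le> \<G> x" "\<And>x. 0 \<le> \<E> x"
    and meas: "(\<lambda>t. \<G> (y t) + \<E> (v t)) \<in> borel_measurable (lebesgue_on {0..T})"
    and r: "integrable (lebesgue_on {0..T}) r" "\<And>t. t \<in> {0..T} \<Longrightarrow> 0 \<le> r t"
    and le: "\<And>t. t \<in> {0..T} \<Longrightarrow> \<G> (x t) \<le> \<G> (y t) + r t" "\<And>t. t \<in> {0..T} \<Longrightarrow> \<E> (u t) \<le> \<E> (v t)"
  shows "cost T \<G> \<E> x u \<le> cost T \<G> \<E> y v + ennreal (LINT t|lebesgue_on {0..T}. r t)"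
proof -
  let ?M = "lebesgue_on {0..T}"
  have meas_r: "r \<in> borel_measurable ?M"
    using r(1) by (rule borel_measurable_integrable)
  have "cost T \<G> \<E> x u \<le> (\<integral>\<^sup>+t. ennreal (\<G> (y t) + \<E> (v t)) + ennreal (r t) \<partial>?M)"
    unfolding cost_def
  proof (rule nn_integral_mono)
    fix t assume "t \<in> space ?M"
    then have t: "t \<in> {0..T}" by simp
    have "\<G> (x t) + \<E> (u t) \<le> (\<G> (y t) + \<E> (v t)) + r t"
      using le[OF t] by simp
    then show "ennreal (\<G> (x t) + \<E> (u t)) \<le> ennreal (\<G> (y t) + \<E> (v t)) + ennreal (r t)"
      using r(2)[OF t] nonneg by (simp add: ennreal_leI flip: ennreal_plus)
  qed
  also have "\<dots> = cost T \<G> \<E> y v + (\<integral>\<^sup>+t. ennreal (r t) \<partial>?M)"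
    unfolding cost_def using meas meas_r by (intro nn_integral_add measurable_compose[OF _ measurable_ennreal])
  also have "(\<integral>\<^sup>+t. ennreal (r t) \<partial>?M) = ennreal (LINT t|?M. r t)"
    using r by (intro nn_integral_eq_integral AE_I2) auto
  finally show ?thesis .
qed

section \<open>Splitting into low and high modes\<close>

text \<open>Membership of \<open>e i\<close> in \<open>D\<close> makes the modes admissible test
  vectors of the weak formulation; membership in \<open>X\<close> places the low modes in the domain
  of \<open>n\<close>.\<close>

locale spectral_splitting =
  fixes X D :: "'a::{real_inner,banach,second_countable_topology} set"
    and n :: "'a \<Rightarrow> real" and L :: "'a \<Rightarrow> 'a" and e :: "nat \<Rightarrow> 'a" and \<beta> :: "nat \<Rightarrow> real"
    and m :: nat and h :: "'a \<Rightarrow> 'a" and C1 C\<alpha> :: real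
  assumes X: "normed_subspace X n" and L: "linear_op_on D L"
    and orthonormal: "\<And>i j. 1 \<le> i \<Longrightarrow> 1 \<le> j \<Longrightarrow> e i \<bullet> e j = (if i = j then 1 else 0)"
    and e_in: "\<And>i. 1 \<le> i \<Longrightarrow> e i \<in> D \<inter> X"
    and eigen: "\<And>i. 1 \<le> i \<Longrightarrow> L (e i) = \<beta> i *\<^sub>R e i"
    and \<beta>_le: "\<And>i. 1 \<le> i \<Longrightarrow> \<beta> i \<le> \<beta> 1"
    and h: "h ` low_modes e m \<subseteq> high_modes e m \<inter> X"
    and h_cont: "continuous_in_norm n (low_modes e m) h"
    and C1: "0 < C1" "\<And>v. v \<in> low_modes e m \<Longrightarrow> n v \<le> C1 * norm v"
    and C\<alpha>: "0 < C\<alpha>" "\<And>v. v \<in> X \<Longrightarrow> norm v \<le> C\<alpha> * n v"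
begin

section \<open>Projection onto the low modes\<close>

abbreviation "Pc \<equiv> P_low e m"
abbreviation "Ps \<equiv> P_high e m"
abbreviation "Hc \<equiv> low_modes e m"

lemmas X_closed = subspace_diff[OF normed_subspaceD(1)[OF X]] subspace_add[OF normed_subspaceD(1)[OF X]]
lemmas n_nonneg = normed_subspace_nonneg[OF X]
lemmas n_triangle = normed_subspaceD(3)[OF X]

lemma Pc_linear: "linear Pc"
  by (rule linearI)
    (simp_all add: P_low_def inner_add_left scaleR_add_left sum.distrib scaleR_sum_right)

lemma Pc_bounded_linear: "bounded_linear Pc"
  unfolding P_low_def
  by (intro bounded_linear_sum bounded_linear_scaleR_const bounded_linear_inner_left)

lemmas Pc_simps = linear_add[OF Pc_linear] linear_diff[OF Pc_linear] linear_0[OF Pc_linear]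
  linear_scale[OF Pc_linear]

lemma Pc_in_Hc [simp]: "Pc v \<in> Hc"
  unfolding P_low_def low_modes_def by (intro span_sum span_scale) (simp add: span_base)

lemma Pc_e: "1 \<le> i \<Longrightarrow> Pc (e i) = (if i \<le> m then e i else 0)"
  by (simp add: P_low_def orthonormal sum.delta' if_distrib[of "\<lambda>r. r *\<^sub>R _"] cong: if_cong)

lemma Pc_Hc [simp]: "v \<in> Hc \<Longrightarrow> Pc v = v"
  unfolding low_modes_def
proof (induction rule: span_induct)
  case base
  show ?case
    unfolding subspace_def by (simp add: Pc_simps)
next
  case (step x)
  then show ?case by (auto simp: Pc_e)
qed

lemma Pc_high: "v \<in> high_modes e m \<Longrightarrow> Pc v = 0"
proof -
  have "span (e ` {m<..}) \<subseteq> {v. Pc v = 0}"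
  proof
    fix x assume "x \<in> span (e ` {m<..})"
    then show "x \<in> {v. Pc v = 0}"
    proof (induction rule: span_induct)
      case base
      show ?case unfolding subspace_def by (simp add: Pc_simps)
    next
      case (step x)
      then show ?case by (auto simp: Pc_e)
    qed
  qed
  moreover have "closed {v. Pc v = 0}"
    by (intro closed_Collect_eq linear_continuous_on Pc_bounded_linear continuous_on_const)
  ultimately show "v \<in> high_modes e m \<Longrightarrow> Pc v = 0"
    unfolding high_modes_def using closure_minimal by blast
qed

lemma Pc_inner: "Pc v \<bullet> w = v \<bullet> Pc w"
  by (simp add: P_low_def inner_sum_left inner_sum_right inner_commute mult.commute)

lemma norm_Pc_le: "norm (Pc v) \<le> norm v"
proof -
  have "(norm (Pc v))\<^sup>2 = v \<bullet> Pc v"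
    using Pc_inner[of v "Pc v"] by (simp add: power2_norm_eq_inner)
  also have "\<dots> \<le> norm v * norm (Pc v)"
    by (rule norm_cauchy_schwarz)
  finally show ?thesis
    by (cases "norm (Pc v) = 0") (auto simp: power2_eq_square)
qed

lemma Hc_subspace: "subspace Hc"
  by (simp add: low_modes_def)

lemma Hc_sub: "Hc \<subseteq> X" "Hc \<subseteq> D"
proof -
  have "subspace D" using L by (simp add: linear_op_on_def)
  then show "Hc \<subseteq> X" "Hc \<subseteq> D"
    unfolding low_modes_def using normed_subspaceD(1)[OF X] e_in
    by (metis Int_iff atLeastAtMost_iff image_subsetI span_minimal)+
qed

lemma Pc_in_X [simp]: "Pc v \<in> X"
  using Hc_sub by auto

lemma Ps_in_X: "v \<in> X \<Longrightarrow> Ps v \<in> X"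
  by (simp add: P_high_def X_closed)

lemma h_in_X: "v \<in> Hc \<Longrightarrow> h v \<in> X"
  using h by blast

lemma Pc_add_h: "v \<in> Hc \<Longrightarrow> Pc (v + h v) = v"
  using h Pc_high[of "h v"] by (auto simp: Pc_simps)

text \<open>The projector is orthogonal only for the ambient inner product, so the bound goes
  through the ambient norm and back.\<close>

lemma n_Pc_le: "v \<in> X \<Longrightarrow> n (Pc v) \<le> C1 * C\<alpha> * n v"
  using C1(2)[of "Pc v"] norm_Pc_le[of v] C\<alpha>(2)[of v] C1(1)
  by (smt (verit) Pc_in_Hc mult.assoc mult_left_mono)

section \<open>The low-mode part of the linear operator and of the equation\<close>

lemma linear_op_on_sum:
  assumes "finite I" "\<And>i. i \<in> I \<Longrightarrow> f i \<in> D"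
  shows "L (\<Sum>i\<in>I. f i) = (\<Sum>i\<in>I. L (f i))"
proof -
  have D: "subspace D" "\<And>x y. x \<in> D \<Longrightarrow> y \<in> D \<Longrightarrow> L (x + y) = L x + L y"
    and L0: "L (0 *\<^sub>R 0) = 0 *\<^sub>R L 0"
    using L subspace_0 unfolding linear_op_on_def by blast+
  show ?thesis
    using assms
  proof (induction I rule: finite_induct)
    case empty
    then show ?case using L0 by simp
  next
    case (insert i I)
    then show ?case
      using D(2)[of "f i" "\<Sum>i\<in>I. f i"] subspace_sum[OF D(1), of I f] by simp
  qed
qed

text \<open>The spectral formula is meaningful on the whole space. A weak solution need not take
  values in \<open>D\<close>, where alone \<open>L\<close> is under control, so
  \<open>Lc (y s)\<close> takes the place of \<open>Pc (L (y s))\<close>.\<close>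

definition Lc :: "'a \<Rightarrow> 'a" where
  "Lc v = (\<Sum>i=1..m. (\<beta> i * (v \<bullet> e i)) *\<^sub>R e i)"

lemma Lc_in_Hc: "Lc v \<in> Hc"
  unfolding Lc_def low_modes_def by (intro span_sum span_scale) (simp add: span_base)

lemma Pc_L: assumes "v \<in> Hc" shows "Pc (L v) = Lc v"
proof -
  have D: "subspace D" and Lsc: "\<And>c x. x \<in> D \<Longrightarrow> L (c *\<^sub>R x) = c *\<^sub>R L x"
    using L by (auto simp: linear_op_on_def)
  have "L v = L (\<Sum>i=1..m. (v \<bullet> e i) *\<^sub>R e i)"
    using Pc_Hc[OF assms] by (simp add: P_low_def)
  also have "\<dots> = (\<Sum>i=1..m. L ((v \<bullet> e i) *\<^sub>R e i))"
    using e_in D by (intro linear_op_on_sum) (auto intro!: subspace_scale)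
  also have "\<dots> = Lc v"
    unfolding Lc_def using e_in Lsc by (intro sum.cong) (auto simp: eigen mult.commute)
  finally show ?thesis
    using Lc_in_Hc by simp
qed

lemma Lc_diff: "Lc v - Lc w = Lc (v - w)"
  by (simp add: Lc_def inner_diff_left right_diff_distrib scaleR_diff_left sum_subtractf)

lemma Lc_Pc: "Lc (Pc v) = Lc v"
proof -
  have "Pc v \<bullet> e i = v \<bullet> e i" if "i \<in> {1..m}" for i
    using Pc_inner[of v "e i"] Pc_e[of i] that by simp
  then show ?thesis
    unfolding Lc_def by (intro sum.cong) auto
qed

lemma Lc_inner_le: assumes "w \<in> Hc" shows "Lc w \<bullet> w \<le> \<beta> 1 * (w \<bullet> w)"
proof -
  have "Lc w \<bullet> w = (\<Sum>i=1..m. \<beta> i * (w \<bullet> e i)\<^sup>2)"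
    unfolding Lc_def inner_sum_left inner_scaleR_left
    by (simp add: power2_eq_square inner_commute mult_ac)
  also have "\<dots> \<le> (\<Sum>i=1..m. \<beta> 1 * (w \<bullet> e i)\<^sup>2)"
    by (intro sum_mono mult_right_mono \<beta>_le) auto
  also have "\<dots> = \<beta> 1 * (Pc w \<bullet> w)"
    unfolding P_low_def inner_sum_left inner_scaleR_left
    by (simp add: power2_eq_square inner_commute sum_distrib_left mult_ac)
  finally show ?thesis
    using assms by simp
qed

text \<open>The weak equation is tested with each \<open>e i\<close>, where
  \<open>y s \<bullet> L (e i) = \<beta> i * (y s \<bullet> e i)\<close>, and the finitely many
  scalar equations are summed into one Bochner integral equation.\<close>

lemma Pc_solves_controlled:
  assumes y: "solves_controlled D L X n B CC T y0 u y" and t: "t \<in> {0..T}"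
  defines "G \<equiv> \<lambda>s. Lc (y s) + Pc (B (y s) (y s) + blinfun_apply CC (u s))"
  shows "integrable (lebesgue_on {0..t}) G"
    and "Pc (y t) = Pc y0 + (LINT s|lebesgue_on {0..t}. G s)"
proof -
  let ?f = "\<lambda>i s. y s \<bullet> L (e i) + (B (y s) (y s) + blinfun_apply CC (u s)) \<bullet> e i"
  have f: "integrable (lebesgue_on {0..t}) (?f i)"
    and eq: "y t \<bullet> e i = y0 \<bullet> e i + (LINT s|lebesgue_on {0..t}. ?f i s)" if "i \<in> {1..m}" for i
    using y t e_in that unfolding solves_controlled_def by auto
  have G: "G = (\<lambda>s. \<Sum>i=1..m. ?f i s *\<^sub>R e i)"
    unfolding G_def Lc_def P_low_def
    by (simp add: eigen scaleR_add_left sum.distrib)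
  show int: "integrable (lebesgue_on {0..t}) G"
    unfolding G using f by (intro Bochner_Integration.integrable_sum integrable_scaleR_left)
  have "(LINT s|lebesgue_on {0..t}. G s) = (\<Sum>i=1..m. (LINT s|lebesgue_on {0..t}. ?f i s) *\<^sub>R e i)"
    unfolding G using f
    by (subst Bochner_Integration.integral_sum) (auto intro!: sum.cong integral_scaleR_left)
  also have "\<dots> = (\<Sum>i=1..m. (y t \<bullet> e i - y0 \<bullet> e i) *\<^sub>R e i)"
    by (intro sum.cong) (auto simp: eq)
  also have "\<dots> = Pc (y t) - Pc y0"
    by (simp add: P_low_def scaleR_diff_left sum_subtractf)
  finally show "Pc (y t) = Pc y0 + (LINT s|lebesgue_on {0..t}. G s)"
    by simp
qed

section \<open>The defect and the distance between lifted and full states\<close>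

definition defect :: "'a \<Rightarrow> real" where
  "defect v = n (Ps v - h (Pc v))"

lemma defect_nonneg: "v \<in> X \<Longrightarrow> 0 \<le> defect v"
  unfolding defect_def by (intro n_nonneg X_closed Ps_in_X h_in_X) simp_all

lemma diff_split: "z + h z - y = ((z - Pc y) + (h z - h (Pc y))) - (Ps y - h (Pc y))"
  by (simp add: P_high_def)

lemma n_gap_le:
  assumes y: "y \<in> X" and z: "z \<in> Hc" and K: "n (h z - h (Pc y)) \<le> K * n (z - Pc y)" "0 \<le> K"
  shows "n (z + h z - y) \<le> C1 * (1 + K) * norm (z - Pc y) + defect y"
proof -
  have mem: "z - Pc y \<in> Hc" "h z \<in> X" "h (Pc y) \<in> X" "Ps y \<in> X" "z \<in> X"
    using z y Hc_subspace Hc_sub by (auto intro: subspace_diff h_in_X Ps_in_X)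
  have "n (z + h z - y) \<le> n ((z - Pc y) + (h z - h (Pc y))) + n (- (Ps y - h (Pc y)))"
    unfolding diff_split[of z y] using mem
    by (subst diff_conv_add_uminus, intro n_triangle)
      (auto intro!: X_closed subspace_neg[OF normed_subspaceD(1)[OF X]])
  also have "n (- (Ps y - h (Pc y))) = defect y"
    unfolding defect_def using mem by (intro normed_subspace_minus[OF X] X_closed)
  also have "n ((z - Pc y) + (h z - h (Pc y))) \<le> n (z - Pc y) + n (h z - h (Pc y))"
    using mem by (intro n_triangle X_closed) auto
  also have "\<dots> \<le> (1 + K) * n (z - Pc y)"
    using K(1) by (simp add: algebra_simps)
  also have "\<dots> \<le> (1 + K) * (C1 * norm (z - Pc y))"
    using C1(2)[OF mem(1)] K(2) by (intro mult_left_mono) auto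
  finally show ?thesis
    by (simp add: mult_ac)
qed

text \<open>The low-mode error is already in the ambient norm; only the increment of
  \<open>h\<close> makes the detour through \<open>n\<close>, at the price
  \<open>C1 * C\<alpha>\<close>. This version serves the running cost, and \<open>n_gap_le\<close>
  serves the bilinear term.\<close>

lemma norm_gap_le:
  assumes y: "y \<in> X" and z: "z \<in> Hc" and K: "n (h z - h (Pc y)) \<le> K * n (z - Pc y)" "0 \<le> K"
  shows "norm (z + h z - y) \<le> (1 + C1 * C\<alpha> * K) * norm (z - Pc y) + C\<alpha> * defect y"
proof -
  have mem: "z - Pc y \<in> Hc" "h z \<in> X" "h (Pc y) \<in> X" "Ps y \<in> X"
    using z y Hc_subspace by (auto intro: subspace_diff h_in_X Ps_in_X)
  have "norm (z + h z - y) \<le> norm (z - Pc y) + norm (h z - h (Pc y)) + norm (Ps y - h (Pc y))"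
    unfolding diff_split[of z y]
    by (rule order_trans[OF norm_triangle_ineq4]) (intro add_mono norm_triangle_ineq order_refl)
  also have "norm (Ps y - h (Pc y)) \<le> C\<alpha> * defect y"
    unfolding defect_def using mem by (intro C\<alpha>(2) X_closed)
  also have "norm (h z - h (Pc y)) \<le> C\<alpha> * n (h z - h (Pc y))"
    using mem by (intro C\<alpha>(2) X_closed)
  also have "\<dots> \<le> C\<alpha> * (K * (C1 * norm (z - Pc y)))"
    using K C\<alpha>(1) C1(2)[OF mem(1)]
    by (intro mult_left_mono order_trans[OF K(1)]) auto
  finally show ?thesis
    by (simp add: algebra_simps)
qed

section \<open>Continuity of \<open>h\<close>, integrability of the defect\<close>

lemma h_sequentially_continuous:
  assumes v: "\<And>k::nat. v k \<in> Hc" "x \<in> Hc" and lim: "v \<longlonglongrightarrow> x"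
  shows "(\<lambda>k. n (h (v k) - h x)) \<longlonglongrightarrow> 0"
proof -
  have "((\<lambda>w. n (h w - h x)) \<longlongrightarrow> n (h x - h x)) (at x within Hc)"
    using h_cont v(2) normed_subspaceD(2)[OF X, of 0] subspace_0[OF normed_subspaceD(1)[OF X]]
    unfolding continuous_in_norm_def by simp
  then have "continuous (at x within Hc) (\<lambda>w. n (h w - h x))"
    by (simp add: continuous_within)
  then have "(\<lambda>k. n (h (v k) - h x)) \<longlonglongrightarrow> n (h x - h x)"
    using v lim by (auto simp: continuous_within_sequentially comp_def)
  then show ?thesis
    using normed_subspaceD(2)[OF X, of 0] subspace_0[OF normed_subspaceD(1)[OF X]] by simp
qed

lemma h_continuous_on: "continuous_on Hc h"
  unfolding continuous_on_sequentially comp_def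
proof clarify
  fix v x assume v: "\<forall>k. v k \<in> Hc" "x \<in> Hc" "v \<longlonglongrightarrow> x"
  have "(\<lambda>k. C\<alpha> * n (h (v k) - h x)) \<longlonglongrightarrow> 0"
    using h_sequentially_continuous[of v x] v by (intro tendsto_mult_right_zero) auto
  moreover have "norm (h (v k) - h x) \<le> C\<alpha> * n (h (v k) - h x)" for k
    using v by (intro C\<alpha>(2) X_closed h_in_X) auto
  ultimately have "(\<lambda>k. h (v k) - h x) \<longlonglongrightarrow> 0"
    by (rule Lim_null_comparison[OF always_eventually[OF allI], rotated])
  then show "(\<lambda>k. h (v k)) \<longlonglongrightarrow> h x"
    by (simp add: LIM_zero_iff)
qed

lemma
  assumes s: "range s \<subseteq> X" "x \<in> X" "(\<lambda>k::nat. n (s k - x)) \<longlonglongrightarrow> 0"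
  shows Ps_sequentially_continuous: "(\<lambda>k. n (Ps (s k))) \<longlonglongrightarrow> n (Ps x)"
    and defect_sequentially_continuous: "(\<lambda>k. defect (s k)) \<longlonglongrightarrow> defect x"
proof -
  have sX: "s k \<in> X" for k using s by auto
  have "(\<lambda>k. s k - x) \<longlonglongrightarrow> 0"
    by (rule Lim_null_comparison[OF always_eventually[OF allI] tendsto_mult_right_zero[OF s(3), of C\<alpha>]])
      (intro C\<alpha>(2) X_closed sX s)
  then have "s \<longlonglongrightarrow> x"
    by (simp add: LIM_zero_iff)
  then have "(\<lambda>k. Pc (s k)) \<longlonglongrightarrow> Pc x"
    by (rule bounded_linear.tendsto[OF Pc_bounded_linear])
  then have hk: "(\<lambda>k. n (h (Pc (s k)) - h (Pc x))) \<longlonglongrightarrow> 0"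
    by (intro h_sequentially_continuous) auto
  have Ps_le: "n (Ps (s k) - Ps x) \<le> (1 + C1 * C\<alpha>) * n (s k - x)" for k
  proof -
    have "Ps (s k) - Ps x = (s k - x) - Pc (s k - x)"
      by (simp add: P_high_def Pc_simps)
    also have "n \<dots> \<le> n (s k - x) + n (- Pc (s k - x))"
      by (subst diff_conv_add_uminus, intro n_triangle subspace_neg[OF normed_subspaceD(1)[OF X]])
        (auto intro: X_closed sX s)
    also have "n (- Pc (s k - x)) = n (Pc (s k - x))"
      by (intro normed_subspace_minus[OF X]) simp
    also have "\<dots> \<le> C1 * C\<alpha> * n (s k - x)"
      by (intro n_Pc_le X_closed sX s)
    finally show ?thesis by (simp add: algebra_simps)
  qed
  have lim: "(\<lambda>k. (1 + C1 * C\<alpha>) * n (s k - x)) \<longlonglongrightarrow> 0"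
    using s(3) by (rule tendsto_mult_right_zero)
  have "(\<lambda>k. n (Ps (s k)) - n (Ps x)) \<longlonglongrightarrow> 0"
  proof (rule Lim_null_comparison[OF always_eventually[OF allI] lim])
    fix k show "norm (n (Ps (s k)) - n (Ps x)) \<le> (1 + C1 * C\<alpha>) * n (s k - x)"
      using normed_subspace_abs_diff_le[OF X Ps_in_X[OF sX] Ps_in_X[OF s(2)], of k] Ps_le[of k] by simp
  qed
  then show "(\<lambda>k. n (Ps (s k))) \<longlonglongrightarrow> n (Ps x)"
    by (simp add: LIM_zero_iff)
  have "(\<lambda>k. (1 + C1 * C\<alpha>) * n (s k - x) + n (h (Pc (s k)) - h (Pc x))) \<longlonglongrightarrow> 0"
    using lim hk by (rule tendsto_add_zero)
  then have "(\<lambda>k. defect (s k) - defect x) \<longlonglongrightarrow> 0"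
  proof (rule Lim_null_comparison[OF always_eventually[OF allI], rotated])
    fix k
    have mem: "Ps (s k) \<in> X" "Ps x \<in> X" "h (Pc (s k)) \<in> X" "h (Pc x) \<in> X"
      using sX s by (auto intro: Ps_in_X h_in_X)
    have "\<bar>defect (s k) - defect x\<bar> \<le> n ((Ps (s k) - h (Pc (s k))) - (Ps x - h (Pc x)))"
      unfolding defect_def using mem by (intro normed_subspace_abs_diff_le[OF X] X_closed)
    also have "(Ps (s k) - h (Pc (s k))) - (Ps x - h (Pc x)) = (Ps (s k) - Ps x) + (h (Pc x) - h (Pc (s k)))"
      by simp
    also have "n \<dots> \<le> n (Ps (s k) - Ps x) + n (h (Pc x) - h (Pc (s k)))"
      using mem by (intro n_triangle X_closed)
    also have "n (h (Pc x) - h (Pc (s k))) = n (h (Pc (s k)) - h (Pc x))"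
      using mem by (intro normed_subspace_diff_commute[OF X])
    finally show "norm (defect (s k) - defect x) \<le> (1 + C1 * C\<alpha>) * n (s k - x) + n (h (Pc (s k)) - h (Pc x))"
      using Ps_le[of k] by simp
  qed
  then show "(\<lambda>k. defect (s k)) \<longlonglongrightarrow> defect x"
    by (simp add: LIM_zero_iff)
qed

lemma h_lipschitz_on_bounded:
  assumes lip: "locally_lipschitz_in_norm n Hc h" and V: "V \<subseteq> X" "\<And>v. v \<in> V \<Longrightarrow> n v \<le> R"
  shows "\<exists>K\<ge>0. \<forall>a\<in>Pc ` V. \<forall>b\<in>Pc ` V. n (h a - h b) \<le> K * n (a - b)"
proof -
  let ?K = "{(\<Sum>i=1..m. c i *\<^sub>R e i) |c. \<forall>i\<in>{1..m}. \<bar>c i\<bar> \<le> C\<alpha> * R}"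
  have "?K \<subseteq> Hc"
    unfolding low_modes_def by (auto intro!: span_sum[of "{Suc 0..m}"] span_scale intro: span_base)
  moreover have "\<exists>M\<ge>0. \<forall>a\<in>?K. \<forall>b\<in>?K. n (h a - h b) \<le> M * n (a - b)"
  proof (rule locally_lipschitz_on_compact[OF X Hc_sub(1) _ lip C\<alpha>(2)])
    show "h ` Hc \<subseteq> X" using h by auto
    show "n (v - w) \<le> C1 * norm (v - w)" if "v \<in> Hc" "w \<in> Hc" for v w
      using that Hc_subspace by (intro C1(2) subspace_diff)
  qed (use calculation compact_bounded_combinations in auto)
  moreover have "Pc v \<in> ?K" if "v \<in> V" for v
  proof -
    have "\<bar>v \<bullet> e i\<bar> \<le> C\<alpha> * R" if "i \<in> {1..m}" for i
    proof -
      have "norm (e i) = 1"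
        using orthonormal[of i i] that by (simp add: norm_eq_sqrt_inner)
      then have "\<bar>v \<bullet> e i\<bar> \<le> norm v"
        using Cauchy_Schwarz_ineq2[of v "e i"] by simp
      also have "\<dots> \<le> C\<alpha> * n v"
        using \<open>v \<in> V\<close> V by (intro C\<alpha>(2)) auto
      also have "\<dots> \<le> C\<alpha> * R"
        using V(2)[OF \<open>v \<in> V\<close>] C\<alpha>(1) by simp
      finally show ?thesis .
    qed
    then show ?thesis
      unfolding P_low_def by (intro CollectI exI[of _ "\<lambda>i. v \<bullet> e i"]) simp
  qed
  then have "Pc ` V \<subseteq> ?K"
    by blast
  ultimately show ?thesis
    by (meson subsetD)
qed

lemma
  assumes y: "y \<in> L2_in X n T" "\<And>t. t \<in> {0..T} \<Longrightarrow> y t \<in> V"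
    and V: "V \<subseteq> X" "\<And>v. v \<in> V \<Longrightarrow> n v \<le> R"
    and K: "0 \<le> K" "\<And>a b. a \<in> Pc ` V \<Longrightarrow> b \<in> Pc ` V \<Longrightarrow> n (h a - h b) \<le> K * n (a - b)"
  shows defect_integrable: "integrable (lebesgue_on {0..T}) (\<lambda>t. defect (y t))"
    and defect_square_integrable: "integrable (lebesgue_on {0..T}) (\<lambda>t. (defect (y t))\<^sup>2)"
    and Ps_square_integrable: "integrable (lebesgue_on {0..T}) (\<lambda>t. (n (Ps (y t)))\<^sup>2)"
proof -
  let ?M = "lebesgue_on {0..T}"
  interpret finite_measure ?M
    by (rule finite_measure_lebesgue_on) simp
  have [measurable]: "(\<lambda>t. defect (y t)) \<in> borel_measurable ?M"
    using y V by (intro borel_measurable_L2_in_compose[of y X n T] defect_sequentially_continuous) auto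
  have [measurable]: "(\<lambda>t. n (Ps (y t))) \<in> borel_measurable ?M"
    using y V by (intro borel_measurable_L2_in_compose[of y X n T] Ps_sequentially_continuous) auto
  have Pc_le: "n (Pc v) \<le> C1 * C\<alpha> * R" if "v \<in> V" for v
    using n_Pc_le[of v] V that C1(1) C\<alpha>(1)
    by (smt (verit) mult_left_mono mult_nonneg_nonneg subset_iff)
  have Ps_le: "n (Ps v) \<le> R + C1 * C\<alpha> * R" if "v \<in> V" for v
  proof -
    have "n (Ps v) \<le> n v + n (- Pc v)"
      unfolding P_high_def using V that
      by (subst diff_conv_add_uminus, intro n_triangle subspace_neg[OF normed_subspaceD(1)[OF X]]) auto
    then show ?thesis
      using Pc_le[OF that] V(2)[OF that] normed_subspace_minus[OF X, of "Pc v"] by simp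
  qed
  define a where "a = Pc (y 0)"
  define S where "S = R + C1 * C\<alpha> * R + n (h a) + K * (2 * (C1 * C\<alpha> * R))"
  have defect_le: "defect v \<le> S" if "v \<in> V" "y 0 \<in> V" for v
  proof -
    have mem: "Ps v \<in> X" "h (Pc v) \<in> X" "h a \<in> X" "0 \<in> X"
      using V that subspace_0[OF normed_subspaceD(1)[OF X]] by (auto simp: a_def intro: Ps_in_X h_in_X)
    have "defect v \<le> n (Ps v - 0) + n (0 - h (Pc v))"
      unfolding defect_def by (rule normed_subspace_triangle_diff[OF X mem(1,4,2)])
    also have "n (0 - h (Pc v)) = n (h (Pc v) - 0)"
      by (rule normed_subspace_diff_commute[OF X mem(4,2)])
    also have "n (h (Pc v) - 0) \<le> n (h (Pc v) - h a) + n (h a - 0)"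
      by (rule normed_subspace_triangle_diff[OF X mem(2,3,4)])
    also have "n (h (Pc v) - h a) \<le> K * n (Pc v - a)"
      using that unfolding a_def by (intro K(2)) auto
    also have "\<dots> \<le> K * (2 * (C1 * C\<alpha> * R))"
    proof (intro mult_left_mono K(1))
      have "n (Pc v - a) \<le> n (Pc v - 0) + n (0 - a)"
        unfolding a_def by (rule normed_subspace_triangle_diff[OF X _ mem(4)]) auto
      then show "n (Pc v - a) \<le> 2 * (C1 * C\<alpha> * R)"
        using Pc_le[OF that(1)] Pc_le[OF that(2)] normed_subspace_minus[OF X, of a] by (simp add: a_def)
    qed
    finally show ?thesis
      using Ps_le[OF that(1)] by (simp add: S_def)
  qed
  have bounds: "norm (defect (y t)) \<le> S" "norm (n (Ps (y t))) \<le> R + C1 * C\<alpha> * R" if "t \<in> {0..T}" for t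
  proof -
    have "y t \<in> V" "y 0 \<in> V" using y(2) that by auto
    then show "norm (defect (y t)) \<le> S" "norm (n (Ps (y t))) \<le> R + C1 * C\<alpha> * R"
      using defect_le[of "y t"] Ps_le[of "y t"] defect_nonneg[of "y t"] n_nonneg[OF Ps_in_X, of "y t"] V
      by auto
  qed
  have squares: "norm ((defect (y t))\<^sup>2) \<le> S\<^sup>2"
    "norm ((n (Ps (y t)))\<^sup>2) \<le> (R + C1 * C\<alpha> * R)\<^sup>2" if "t \<in> {0..T}" for t
    unfolding norm_power by (intro power_mono bounds that norm_ge_zero)+
  show "integrable ?M (\<lambda>t. defect (y t))"
    by (rule integrable_const_bound[where B = S]) (use bounds in auto)
  show "integrable ?M (\<lambda>t. (defect (y t))\<^sup>2)"
    by (rule integrable_const_bound[where B = "S\<^sup>2"])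
      (use squares in auto)
  show "integrable ?M (\<lambda>t. (n (Ps (y t)))\<^sup>2)"
    by (rule integrable_const_bound[where B = "(R + C1 * C\<alpha> * R)\<^sup>2"])
      (use squares in auto)
qed

text \<open>The denominator of the defect quotient cancels once it is nonzero. Since
  \<open>y\<close> is continuous only in the ambient norm, positivity of the integral is shown there
  and transferred to \<open>n\<close> by \<open>C\<alpha>\<close>.\<close>

lemma sqrt_param_defect_mult:
  assumes T: "0 < T" and y: "continuous_on {0..T} y" "\<And>t. t \<in> {0..T} \<Longrightarrow> y t \<in> X"
    and int: "integrable (lebesgue_on {0..T}) (\<lambda>t. (n (Ps (y t)))\<^sup>2)"
    and nz: "\<exists>t\<in>{0..T}. Ps (y t) \<noteq> 0"
  shows "sqrt (param_defect n e m h T y) * L2_norm n T (\<lambda>t. Ps (y t))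
    = sqrt (LINT t|lebesgue_on {0..T}. (defect (y t))\<^sup>2)"
proof -
  let ?M = "lebesgue_on {0..T}"
  have cont: "continuous_on {0..T} (\<lambda>t. (norm (Ps (y t)))\<^sup>2)"
    unfolding P_high_def using y(1)
    by (intro continuous_intros bounded_linear.continuous_on[OF Pc_bounded_linear])
  have "(LINT t|?M. (norm (Ps (y t)))\<^sup>2) \<noteq> 0"
    using integralL_eq_0_iff[OF cont T] nz by auto
  moreover have "(LINT t|?M. (norm (Ps (y t)))\<^sup>2) \<le> (LINT t|?M. C\<alpha>\<^sup>2 * (n (Ps (y t)))\<^sup>2)"
  proof (rule integral_mono)
    show "integrable ?M (\<lambda>t. (norm (Ps (y t)))\<^sup>2)"
      using cont by (rule continuous_imp_integrable_real)
    show "integrable ?M (\<lambda>t. C\<alpha>\<^sup>2 * (n (Ps (y t)))\<^sup>2)"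
      using int by simp
    fix t assume "t \<in> space ?M"
    then have "Ps (y t) \<in> X"
      using y(2) by (auto intro: Ps_in_X)
    then show "(norm (Ps (y t)))\<^sup>2 \<le> C\<alpha>\<^sup>2 * (n (Ps (y t)))\<^sup>2"
      unfolding power_mult_distrib[symmetric] by (intro power_mono C\<alpha>(2)) auto
  qed
  moreover have "0 \<le> (LINT t|?M. (norm (Ps (y t)))\<^sup>2)"
    by simp
  ultimately have "0 < C\<alpha>\<^sup>2 * (LINT t|?M. (n (Ps (y t)))\<^sup>2)"
    unfolding integral_mult_right_zero by linarith
  then have "(LINT t|?M. (n (Ps (y t)))\<^sup>2) \<noteq> 0"
    by auto
  then show ?thesis
    unfolding param_defect_def L2_norm_def defect_def[symmetric]
    by (simp flip: real_sqrt_mult)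
qed

section \<open>Error of the reduced trajectory\<close>

lemma tracking_estimate:
  assumes y: "solves_controlled D L X n B CC T y0 u y" and z: "solves_reduced e m L B CC h T (Pc y0) v z"
    and V: "V \<subseteq> X" "\<And>t. t \<in> {0..T} \<Longrightarrow> y t \<in> V" "\<And>t. t \<in> {0..T} \<Longrightarrow> z t + h (z t) \<in> V"
    and K: "0 \<le> K" "\<And>a b. a \<in> Pc ` V \<Longrightarrow> b \<in> Pc ` V \<Longrightarrow> n (h a - h b) \<le> K * n (a - b)"
    and B: "\<And>v w. v \<in> X \<Longrightarrow> w \<in> X \<Longrightarrow> norm (B v v - B w w) \<le> CB * (n v + n w) * n (v - w)"
    and CV: "0 \<le> CV" "\<And>t. t \<in> {0..T} \<Longrightarrow> CB * (n (y t) + n (z t + h (z t))) \<le> CV"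
    and k: "k = 1 + \<beta> 1 + C1 * CV * (1 + K)" "0 \<le> k"
    and d: "integrable (lebesgue_on {0..T}) (\<lambda>t. (defect (y t))\<^sup>2)"
    and uv: "integrable (lebesgue_on {0..T}) (\<lambda>t. (norm (v t - u t))\<^sup>2)"
    and t: "t \<in> {0..T}"
  shows "(norm (z t - Pc (y t)))\<^sup>2 \<le> exp (2 * k * T) *
    (CV\<^sup>2 * (LINT s|lebesgue_on {0..T}. (defect (y s))\<^sup>2)
      + (norm CC)\<^sup>2 * (LINT s|lebesgue_on {0..T}. (norm (v s - u s))\<^sup>2))"
proof -
  \<comment> \<open>Both low-mode trajectories start at \<open>Pc y0\<close>, so \<open>w\<close> is
    exactly the integral of \<open>gz - gy\<close>. The forcing \<open>f\<close> collects what the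
    energy estimate leaves besides multiples of \<open>w s \<bullet> w s\<close>.\<close>
  define w where "w s = z s - Pc (y s)" for s
  define gy where "gy s = Lc (y s) + Pc (B (y s) (y s) + blinfun_apply CC (u s))" for s
  define gz where "gz s = Pc (L (z s)) + Pc (B (z s + h (z s)) (z s + h (z s)))
    + Pc (blinfun_apply CC (v s))" for s
  define f where "f s = CV\<^sup>2 * (defect (y s))\<^sup>2 + (norm CC)\<^sup>2 * (norm (v s - u s))\<^sup>2" for s
  have gy: "integrable (lebesgue_on {0..s}) gy" "Pc (y s) = Pc y0 + (LINT r|lebesgue_on {0..s}. gy r)"
    if "s \<in> {0..T}" for s
    using Pc_solves_controlled[OF y that] unfolding gy_def by auto
  have gz: "integrable (lebesgue_on {0..s}) gz" "z s = Pc y0 + (LINT r|lebesgue_on {0..s}. gz r)"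
    if "s \<in> {0..T}" for s
    using z that unfolding solves_reduced_def gz_def Let_def by auto
  have zH: "z s \<in> Hc" if "s \<in> {0..T}" for s
    using z that unfolding solves_reduced_def by auto
  have yX: "y s \<in> X" if "s \<in> {0..T}" for s
    using V that by auto
  have wH: "w s \<in> Hc" if "s \<in> {0..T}" for s
    unfolding w_def using zH[OF that] Hc_subspace by (intro subspace_diff) auto
  have cont: "continuous_on {0..T} w"
    unfolding w_def using y z unfolding solves_controlled_def solves_reduced_def
    by (intro continuous_on_diff bounded_linear.continuous_on[OF Pc_bounded_linear]) auto
  have pointwise: "2 * (w s \<bullet> (gz s - gy s)) \<le> 2 * k * (w s \<bullet> w s) + f s" if s: "s \<in> {0..T}" for s
  proof -
    let ?l = "z s + h (z s)"
    define q where "q = norm (w s)"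
    define c where "c = norm CC * norm (v s - u s)"
    have lX: "?l \<in> X" using V s by auto
    \<comment> \<open>As \<open>w s\<close> is a low mode and \<open>Pc\<close> is symmetric, the
      projections drop out of the inner product.\<close>
    have inner_Pc: "w s \<bullet> Pc x = w s \<bullet> x" for x
      using Pc_inner[of "w s" x] wH[OF s] by simp
    have "gz s - gy s = Lc (z s - y s) + Pc ((B ?l ?l - B (y s) (y s)) + blinfun_apply CC (v s - u s))"
      unfolding gz_def gy_def by (simp add: Pc_L[OF zH[OF s]] Lc_diff[symmetric] Pc_simps blinfun.diff_right)
    moreover have "Lc (z s - y s) = Lc (w s)"
      using Lc_Pc[of "z s - y s"] zH[OF s] by (simp add: w_def Pc_simps)
    ultimately have "w s \<bullet> (gz s - gy s) = Lc (w s) \<bullet> w s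
        + w s \<bullet> (B ?l ?l - B (y s) (y s)) + w s \<bullet> blinfun_apply CC (v s - u s)"
      using inner_Pc by (simp add: inner_add_right inner_commute[of "Lc (w s)"])
    moreover have "Lc (w s) \<bullet> w s \<le> \<beta> 1 * q\<^sup>2"
      using Lc_inner_le[OF wH[OF s]] by (simp add: q_def power2_norm_eq_inner)
    moreover have "w s \<bullet> (B ?l ?l - B (y s) (y s)) \<le> q * (CV * (C1 * (1 + K) * q + defect (y s)))"
    proof -
      have "z s \<in> Pc ` V" "Pc (y s) \<in> Pc ` V"
        using Pc_add_h[OF zH[OF s]] V s by (auto intro: image_eqI[of _ _ "?l"])
      then have "n (?l - y s) \<le> C1 * (1 + K) * q + defect (y s)"
        unfolding q_def w_def by (intro n_gap_le yX zH K s)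
      moreover have "norm (B ?l ?l - B (y s) (y s)) \<le> CV * n (?l - y s)"
        using B[OF lX yX[OF s]] CV(2)[OF s] n_nonneg[OF X_closed(1)[OF lX yX[OF s]]]
        by (smt (verit) add.commute mult_right_mono)
      ultimately have "norm (B ?l ?l - B (y s) (y s)) \<le> CV * (C1 * (1 + K) * q + defect (y s))"
        using CV(1) by (smt (verit) mult_left_mono)
      then show ?thesis
        unfolding q_def by (rule order_trans[OF norm_cauchy_schwarz mult_left_mono]) simp
    qed
    moreover have "w s \<bullet> blinfun_apply CC (v s - u s) \<le> q * c"
      unfolding q_def c_def
      by (rule order_trans[OF norm_cauchy_schwarz mult_left_mono[OF norm_blinfun]]) simp
    moreover have "2 * (q * (CV * defect (y s))) \<le> q\<^sup>2 + (CV * defect (y s))\<^sup>2" "2 * (q * c) \<le> q\<^sup>2 + c\<^sup>2"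
      using sum_squares_bound[of q "CV * defect (y s)"] sum_squares_bound[of q c] by (simp_all add: mult_ac)
    ultimately have "2 * (w s \<bullet> (gz s - gy s)) \<le> 2 * k * q\<^sup>2 + ((CV * defect (y s))\<^sup>2 + c\<^sup>2)"
      unfolding k(1) by (simp add: algebra_simps power2_eq_square)
    then show ?thesis
      by (simp add: f_def c_def q_def power_mult_distrib power2_norm_eq_inner)
  qed
  have f: "integrable (lebesgue_on {0..T}) f"
    unfolding f_def using d uv by simp
  have f_nonneg: "0 \<le> f r" for r
    by (simp add: f_def)
  have "w s \<bullet> w s \<le> (LINT r|lebesgue_on {0..T}. f r) + 2 * k * (LINT r|lebesgue_on {0..s}. w r \<bullet> w r)"
    if s: "s \<in> {0..T}" for s
  proof -
    let ?M = "lebesgue_on {0..s}"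
    have sub: "r \<in> {0..s} \<Longrightarrow> r \<in> {0..T}" for r
      using s by auto
    have g: "integrable ?M (\<lambda>r. gz r - gy r)"
      using gy(1)[OF s] gz(1)[OF s] by simp
    have contw: "continuous_on {0..s} w"
      using cont by (rule continuous_on_subset) (use sub in auto)
    have fs: "integrable ?M f"
      using f by (rule integrable_lebesgue_on_subset) (use sub in auto)
    have ww: "integrable ?M (\<lambda>r. w r \<bullet> w r)"
      by (intro continuous_imp_integrable_real continuous_intros contw)
    have "w s \<bullet> w s = 2 * (LINT r|?M. w r \<bullet> (gz r - gy r))"
    proof (rule inner_self_eq_integral[OF contw g])
      fix r assume "r \<in> {0..s}"
      then have r: "r \<in> {0..T}" using sub by blast
      show "w r = (LINT q|lebesgue_on {0..r}. gz q - gy q)"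
        using gy[OF r] gz[OF r] by (simp add: w_def)
    qed (use s in simp)
    also have "\<dots> = (LINT r|?M. 2 * (w r \<bullet> (gz r - gy r)))"
      by simp
    also have "\<dots> \<le> (LINT r|?M. 2 * k * (w r \<bullet> w r) + f r)"
      using integrable_continuous_inner[OF contw g] ww fs s
      by (intro integral_mono pointwise) auto
    also have "\<dots> = 2 * k * (LINT r|?M. w r \<bullet> w r) + (LINT r|?M. f r)"
      using ww fs by simp
    also have "(LINT r|?M. f r) \<le> (LINT r|lebesgue_on {0..T}. f r)"
      using f s f_nonneg by (intro integral_mono_lebesgue_on_AE) auto
    finally show ?thesis by simp
  qed
  then have "w t \<bullet> w t \<le> exp (2 * k * t) * (LINT r|lebesgue_on {0..T}. f r)"
    using cont t k(2) by (intro gronwall[of T "\<lambda>r. w r \<bullet> w r"] continuous_intros) auto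
  \<comment> \<open>Nonnegativity of \<open>k\<close> permits replacing \<open>t\<close> by
    \<open>T\<close>. The rate \<open>2 * k\<close> belongs to the squared norm and becomes
    \<open>k\<close> after taking roots.\<close>
  also have "\<dots> \<le> exp (2 * k * T) * (LINT r|lebesgue_on {0..T}. f r)"
    using t k(2) f_nonneg by (intro mult_right_mono) (auto intro!: mult_left_mono)
  also have "(LINT r|lebesgue_on {0..T}. f r) = CV\<^sup>2 * (LINT s|lebesgue_on {0..T}. (defect (y s))\<^sup>2)
      + (norm CC)\<^sup>2 * (LINT s|lebesgue_on {0..T}. (norm (v s - u s))\<^sup>2)"
    unfolding f_def using d uv by simp
  finally show ?thesis
    by (simp add: w_def power2_norm_eq_inner)
qed

text \<open>The majorant \<open>r\<close> is a constant plus a multiple of the defect: integrating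
  the constant produces the factor \<open>T\<close>, and Cauchy-Schwarz on the defect produces
  \<open>sqrt T\<close>.\<close>

lemma integrated_gap:
  assumes T: "0 < T"
    and y: "solves_controlled D L X n B CC T y0 u y" and z: "solves_reduced e m L B CC h T (Pc y0) v z"
    and V: "V \<subseteq> X" "\<And>t. t \<in> {0..T} \<Longrightarrow> y t \<in> V" "\<And>t. t \<in> {0..T} \<Longrightarrow> z t + h (z t) \<in> V"
    and K: "0 \<le> K" "\<And>a b. a \<in> Pc ` V \<Longrightarrow> b \<in> Pc ` V \<Longrightarrow> n (h a - h b) \<le> K * n (a - b)"
    and B: "\<And>v w. v \<in> X \<Longrightarrow> w \<in> X \<Longrightarrow> norm (B v v - B w w) \<le> CB * (n v + n w) * n (v - w)"
    and CV: "0 \<le> CV" "\<And>t. t \<in> {0..T} \<Longrightarrow> CB * (n (y t) + n (z t + h (z t))) \<le> CV"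
    and k: "k = 1 + \<beta> 1 + C1 * CV * (1 + K)" "0 \<le> k"
    and d: "integrable (lebesgue_on {0..T}) (\<lambda>t. defect (y t))"
      "integrable (lebesgue_on {0..T}) (\<lambda>t. (defect (y t))\<^sup>2)"
    and uv: "integrable (lebesgue_on {0..T}) (\<lambda>t. (norm (v t - u t))\<^sup>2)"
  obtains r where "integrable (lebesgue_on {0..T}) r"
    "\<And>t. t \<in> {0..T} \<Longrightarrow> norm (z t + h (z t) - y t) \<le> r t"
    "(LINT t|lebesgue_on {0..T}. r t) \<le>
      C\<alpha> * sqrt T * sqrt (LINT t|lebesgue_on {0..T}. (defect (y t))\<^sup>2)
      + max CV 1 * T * (1 + C1 * C\<alpha> * K) * exp (k * T)
        * (sqrt (LINT t|lebesgue_on {0..T}. (defect (y t))\<^sup>2) + norm CC * L2_norm norm T (\<lambda>t. v t - u t))"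
proof -
  let ?M = "lebesgue_on {0..T}"
  define \<delta> where "\<delta> = sqrt (LINT t|?M. (defect (y t))\<^sup>2)"
  define \<eta> where "\<eta> = norm CC * L2_norm norm T (\<lambda>t. v t - u t)"
  define c where "c = 1 + C1 * C\<alpha> * K"
  define W where "W = max CV 1 * exp (k * T) * (\<delta> + \<eta>)"
  define r where "r t = c * W + C\<alpha> * defect (y t)" for t
  interpret finite_measure ?M
    by (rule finite_measure_lebesgue_on) simp
  have \<delta>: "0 \<le> \<delta>" "\<delta>\<^sup>2 = (LINT t|?M. (defect (y t))\<^sup>2)"
    by (simp_all add: \<delta>_def)
  have \<eta>: "0 \<le> \<eta>" "\<eta>\<^sup>2 = (norm CC)\<^sup>2 * (LINT t|?M. (norm (v t - u t))\<^sup>2)"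
    by (simp_all add: \<eta>_def L2_norm_def power_mult_distrib)
  have c: "0 \<le> c"
    using C1(1) C\<alpha>(1) K(1) by (simp add: c_def)
  have W: "norm (z t - Pc (y t)) \<le> W" if t: "t \<in> {0..T}" for t
  proof -
    have "(norm (z t - Pc (y t)))\<^sup>2 \<le> exp (2 * k * T) * (CV\<^sup>2 * \<delta>\<^sup>2 + \<eta>\<^sup>2)"
      unfolding \<delta>(2) \<eta>(2) by (rule tracking_estimate[OF y z V K B CV k d(2) uv t])
    also have "\<dots> \<le> exp (2 * k * T) * ((max CV 1 * (\<delta> + \<eta>))\<^sup>2)"
    \<comment> \<open>\<open>CV\<close> multiplies only the defect. Enlarging both coefficients to
      \<open>max CV 1\<close> and adding the nonnegative cross term completes a square.\<close>
    proof (intro mult_left_mono)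
      have "CV\<^sup>2 * \<delta>\<^sup>2 \<le> (max CV 1)\<^sup>2 * \<delta>\<^sup>2"
        using CV(1) by (intro mult_right_mono power_mono) auto
      moreover have "1 * \<eta>\<^sup>2 \<le> (max CV 1)\<^sup>2 * \<eta>\<^sup>2"
        by (intro mult_right_mono one_le_power) auto
      moreover have "0 \<le> 2 * (max CV 1 * \<delta>) * (max CV 1 * \<eta>)"
        using \<delta>(1) \<eta>(1) by simp
      ultimately show "CV\<^sup>2 * \<delta>\<^sup>2 + \<eta>\<^sup>2 \<le> (max CV 1 * (\<delta> + \<eta>))\<^sup>2"
        unfolding power_mult_distrib power2_sum distrib_left by linarith
    qed simp
    also have "\<dots> = W\<^sup>2"
      by (simp add: W_def power_mult_distrib exp_double[symmetric] mult_ac)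
    finally show ?thesis
      by (rule power2_le_imp_le) (use \<delta>(1) \<eta>(1) in \<open>simp add: W_def\<close>)
  qed
  show thesis
  proof (rule that[folded \<delta>_def \<eta>_def c_def])
    show "integrable ?M r"
      unfolding r_def using d(1) by simp
    show "norm (z t + h (z t) - y t) \<le> r t" if t: "t \<in> {0..T}" for t
    proof -
      have zH: "z t \<in> Hc"
        using z t unfolding solves_reduced_def by auto
      have "z t \<in> Pc ` V" "Pc (y t) \<in> Pc ` V"
        using Pc_add_h[OF zH] V t by (auto intro: image_eqI[of _ _ "z t + h (z t)"])
      then have "norm (z t + h (z t) - y t) \<le> c * norm (z t - Pc (y t)) + C\<alpha> * defect (y t)"
        unfolding c_def using V t by (intro norm_gap_le zH K) auto
      then show ?thesis
        using mult_left_mono[OF W[OF t] c] by (simp add: r_def)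
    qed
    have "(LINT t|?M. r t) = c * W * T + C\<alpha> * (LINT t|?M. defect (y t))"
      unfolding r_def using d(1) T by (simp add: measure_restrict_space)
    also have "\<dots> \<le> c * W * T + C\<alpha> * (sqrt T * \<delta>)"
      using integral_le_sqrt_mult_sqrt_integral[OF T d] C\<alpha>(1) by (simp add: \<delta>_def)
    finally show "(LINT t|?M. r t) \<le> C\<alpha> * sqrt T * \<delta> + max CV 1 * T * c * exp (k * T) * (\<delta> + \<eta>)"
      by (simp add: W_def mult_ac)
  qed
qed

end

section \<open>The error estimate\<close>

theorem theorem4p1:
  fixes H1 H\<alpha> :: "'a::{real_inner,banach,second_countable_topology} set"
    and n1 n\<alpha> :: "'a \<Rightarrow> real"
    and \<alpha> lam T \<sigma> C1 C\<alpha> CB CV :: real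
    and A L :: "'a \<Rightarrow> 'a"
    and Blam :: "real \<Rightarrow> 'a \<Rightarrow> 'a"
    and \<beta> :: "nat \<Rightarrow> real"
    and e :: "nat \<Rightarrow> 'a"
    and B :: "'a \<Rightarrow> 'a \<Rightarrow> 'a"
    and \<CC> :: "'a \<Rightarrow>\<^sub>L 'a"
    and y0 :: 'a
    and \<G> \<E> :: "'a \<Rightarrow> real"
    and m :: nat
    and h :: "'a \<Rightarrow> 'a"
    and \<V>pm V :: "'a set"
    and \<U>pm \<U> :: "(real \<Rightarrow> 'a) set"
    and ustar uR ystar yR zstar zR :: "real \<Rightarrow> 'a"
  defines "sol \<equiv> solves_controlled H1 L H\<alpha> n\<alpha> B \<CC>"
    and "red \<equiv> solves_reduced e m L B \<CC> h T (P_low e m y0)"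
    and "L2c \<equiv> {u \<in> L2 T. AE t in lebesgue_on {0..T}. u t \<in> low_modes e m}"
    and "J \<equiv> cost T \<G> \<E>"
    and "JR \<equiv> (\<lambda>z. cost T \<G> \<E> (\<lambda>t. z t + h (z t)))"
    and "LipG \<equiv> lip_const norm norm V \<G>"
    and "Liph \<equiv> lip_const n\<alpha> n\<alpha> (P_low e m ` V) h"
  assumes "T > 0" and "0 \<le> \<alpha>" and "\<alpha> < 1"
    \<comment> \<open>functional setting\<close>
    and "normed_subspace H1 n1" and "complete_in_norm H1 n1"
    and "compactly_densely_embedded H1 n1"
    and "sectorial H1 A" and "\<forall>\<zeta>\<in>spectrum_of H1 (\<lambda>x. - A x). Re \<zeta> < 0"
    and "interpolated_space \<alpha> H1 n1 H\<alpha> n\<alpha>"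
    and "\<forall>\<mu>. bounded_op_on H\<alpha> n\<alpha> (Blam \<mu>)"
    and "\<forall>\<mu>. \<forall>\<epsilon>>0. \<exists>\<delta>>0. \<forall>\<nu>. \<bar>\<nu> - \<mu>\<bar> < \<delta> \<longrightarrow>
           (\<forall>v\<in>H\<alpha>. norm (Blam \<nu> v - Blam \<mu> v) \<le> \<epsilon> * n\<alpha> v)"
    and "L = (\<lambda>x. - A x + Blam lam x)" and "self_adjoint_op H1 L"
    and "hilbert_basis e"
    and "\<forall>i\<ge>1. e i \<in> H1 \<inter> H\<alpha> \<and> L (e i) = \<beta> i *\<^sub>R e i"
    and "\<forall>i\<ge>1. \<beta> (Suc i) \<le> \<beta> i"
    and "continuous_bilinear_on H\<alpha> n\<alpha> B"
    and "\<CC> \<noteq> 0"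
    \<comment> \<open>well-posedness and regularity\<close>
    and "\<forall>T'>0. \<forall>x0. \<forall>u\<in>L2 T'.
           (\<exists>y. sol T' x0 u y) \<and>
           (\<forall>y y'. sol T' x0 u y \<and> sol T' x0 u y' \<longrightarrow> (\<forall>t\<in>{0..T'}. y t = y' t))"
    and "\<forall>T'>0. \<forall>x0\<in>H\<alpha>. \<forall>u\<in>L2 T'. \<forall>y. sol T' x0 u y \<longrightarrow>
           y ` {0..T'} \<subseteq> H\<alpha> \<and> continuous_in_norm n\<alpha> {0..T'} y \<and> y \<in> L2_in H1 n1 T'"
    \<comment> \<open>cost\<close>
    and "\<forall>x. 0 \<le> \<G> x" and "\<forall>x. 0 \<le> \<E> x"
    and "continuous_on UNIV \<G>" and "continuous_on UNIV \<E>"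
    and "\<forall>S. bounded S \<longrightarrow> (\<exists>K. K-lipschitz_on S \<G>)"
    and "\<forall>u v. norm u \<le> norm v \<longrightarrow> \<E> u \<le> \<E> v"
    \<comment> \<open>PM function and reduced system\<close>
    and "(\<lambda>v. P_low e m (blinfun_apply \<CC> (P_low e m v))) \<noteq> (\<lambda>v. 0)"
    and "finite_horizon_PM (sol T) H\<alpha> n\<alpha> e m T \<V>pm \<U>pm h"
    and "locally_lipschitz_in_norm n\<alpha> (low_modes e m) h"
    and "\<forall>z0\<in>low_modes e m. \<forall>u\<in>L2c. \<exists>z. solves_reduced e m L B \<CC> h T z0 u z"
    \<comment> \<open>optimal pairs, and the second-order sufficient condition\<close>
    and "is_arg_min (\<lambda>(y, u). J y u)
           (\<lambda>(y, u). y \<in> L2 T \<and> u \<in> L2 T \<and> sol T y0 u y) (ystar, ustar)"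
    and "J ystar ustar < \<infinity>"
    and "is_arg_min (\<lambda>(z, u). JR z u)
           (\<lambda>(z, u). z \<in> L2c \<and> u \<in> L2c \<and> red u z) (zR, uR)"
    and "\<sigma> > 0"
    and "\<U> \<subseteq> L2 T"
    and "\<exists>\<W>. open_in_norm (L2_norm norm T) (L2 T) \<W> \<and> ustar \<in> \<W> \<and> \<W> \<subseteq> \<U>"
    and "\<forall>v\<in>\<U>. \<forall>y. sol T y0 v y \<longrightarrow>
           J y v \<ge> J ystar ustar + ennreal (\<sigma> * (L2_norm norm T (v - ustar))\<^sup>2)"
    and "uR \<in> \<U>"
    \<comment> \<open>the remaining trajectories\<close>
    and "sol T y0 uR yR"
    and "red (\<lambda>t. P_low e m (ustar t)) zstar"
    \<comment> \<open>both defects are defined\<close>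
    and "\<exists>t\<in>{0..T}. P_high e m (yR t) \<noteq> 0" and "\<exists>t\<in>{0..T}. P_high e m (ystar t) \<noteq> 0"
    \<comment> \<open>constants\<close>
    and "V \<subseteq> H\<alpha>" and "\<exists>R. \<forall>v\<in>V. n\<alpha> v \<le> R"
    and "\<forall>t\<in>{0..T}. yR t \<in> V \<and> zR t + h (zR t) \<in> V \<and> ystar t \<in> V \<and> zstar t + h (zstar t) \<in> V"
    and "C1 > 0" and "\<forall>v\<in>low_modes e m. n\<alpha> v \<le> C1 * norm v"
    and "C\<alpha> > 0" and "\<forall>v\<in>H\<alpha>. norm v \<le> C\<alpha> * n\<alpha> v"
    and "CB > 0" and "\<forall>v\<in>H\<alpha>. \<forall>w\<in>H\<alpha>. norm (B v v - B w w) \<le> CB * (n\<alpha> v + n\<alpha> w) * n\<alpha> (v - w)"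
    and "CV > 0"
    and "\<forall>t\<in>{0..T}. CB * (n\<alpha> (yR t) + n\<alpha> (zR t + h (zR t))) \<le> CV \<and>
                    CB * (n\<alpha> (ystar t) + n\<alpha> (zstar t + h (zstar t))) \<le> CV"
    \<comment> \<open>\<open>CV\<close> is taken large enough for the exponent of the error constant to be nonnegative\<close>
    and "0 \<le> 1 + \<beta> 1 + C1 * CV * (1 + Liph)"
  shows "(L2_norm norm T (uR - ustar))\<^sup>2 \<le>
     (2 * C\<alpha> * sqrt T * LipG
        + 2 * max CV 1 * T * LipG * (1 + C1 * C\<alpha> * Liph)
            * exp ((1 + \<beta> 1 + C1 * CV * (1 + Liph)) * T)) / \<sigma>
     * (sqrt (param_defect n\<alpha> e m h T yR) * L2_norm n\<alpha> T (\<lambda>t. P_high e m (yR t))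
        + sqrt (param_defect n\<alpha> e m h T ystar) * L2_norm n\<alpha> T (\<lambda>t. P_high e m (ystar t))
        + norm \<CC> * L2_norm norm T (\<lambda>t. P_high e m (ustar t)))"
proof -
  let ?M = "lebesgue_on {0..T}"
  let ?u = "\<lambda>t. P_low e m (ustar t)"
  note T = \<open>T > 0\<close>
  have basis: "e i \<bullet> e j = (if i = j then 1 else 0)" if "1 \<le> i" "1 \<le> j" for i j
    using \<open>hilbert_basis e\<close> that unfolding hilbert_basis_def by blast
  have \<beta>_le: "\<beta> i \<le> \<beta> 1" if "1 \<le> i" for i
    using that
  proof (induction i rule: dec_induct)
    case (step i)
    then show ?case
      using \<open>\<forall>i\<ge>1. \<beta> (Suc i) \<le> \<beta> i\<close> order_trans by blast
  qed simp
  have PM: "h ` low_modes e m \<subseteq> high_modes e m \<inter> H\<alpha>" "continuous_in_norm n\<alpha> (low_modes e m) h"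
    using \<open>finite_horizon_PM (sol T) H\<alpha> n\<alpha> e m T \<V>pm \<U>pm h\<close> unfolding finite_horizon_PM_def by auto
  interpret spectral_splitting H\<alpha> H1 n\<alpha> L e \<beta> m h C1 C\<alpha>
  proof
    show "normed_subspace H\<alpha> n\<alpha>"
      using \<open>interpolated_space \<alpha> H1 n1 H\<alpha> n\<alpha>\<close> unfolding interpolated_space_def by blast
    show "linear_op_on H1 L"
      using \<open>self_adjoint_op H1 L\<close> unfolding self_adjoint_op_def by simp
    show "e i \<in> H1 \<inter> H\<alpha>" "L (e i) = \<beta> i *\<^sub>R e i" if "1 \<le> i" for i
      using \<open>\<forall>i\<ge>1. e i \<in> H1 \<inter> H\<alpha> \<and> L (e i) = \<beta> i *\<^sub>R e i\<close> that by blast+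
    show "n\<alpha> v \<le> C1 * norm v" if "v \<in> low_modes e m" for v
      using \<open>\<forall>v\<in>low_modes e m. n\<alpha> v \<le> C1 * norm v\<close> that by blast
    show "norm v \<le> C\<alpha> * n\<alpha> v" if "v \<in> H\<alpha>" for v
      using \<open>\<forall>v\<in>H\<alpha>. norm v \<le> C\<alpha> * n\<alpha> v\<close> that by blast
  qed (fact basis \<beta>_le PM \<open>C1 > 0\<close> \<open>C\<alpha> > 0\<close>)+

  \<comment> \<open>Lipschitz constants on \<open>V\<close>\<close>
  obtain R where R: "\<And>v. v \<in> V \<Longrightarrow> n\<alpha> v \<le> R"
    using \<open>\<exists>R. \<forall>v\<in>V. n\<alpha> v \<le> R\<close> by blast
  note V = \<open>V \<subseteq> H\<alpha>\<close>
  have inV: "yR t \<in> V" "zR t + h (zR t) \<in> V" "ystar t \<in> V" "zstar t + h (zstar t) \<in> V" if "t \<in> {0..T}" for t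
    using \<open>\<forall>t\<in>{0..T}. yR t \<in> V \<and> zR t + h (zR t) \<in> V \<and> ystar t \<in> V \<and> zstar t + h (zstar t) \<in> V\<close> that
    by blast+

  \<comment> \<open>The Lipschitz hypothesis on \<open>\<G>\<close> is about sets bounded in the
    ambient norm, whereas \<open>V\<close> is given as bounded in \<open>n\<alpha>\<close>.\<close>
  have bounded_V: "bounded V"
    unfolding bounded_iff
  proof (intro exI ballI)
    fix v assume "v \<in> V"
    then show "norm v \<le> C\<alpha> * R"
      using C\<alpha>(2)[of v] R[of v] V C\<alpha>(1) by (smt (verit) mult_left_mono subsetD)
  qed
  then obtain KG where "KG-lipschitz_on V \<G>"
    using \<open>\<forall>S. bounded S \<longrightarrow> (\<exists>K. K-lipschitz_on S \<G>)\<close> by blast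
  then have KG: "0 \<le> KG" "\<And>x y. x \<in> V \<Longrightarrow> y \<in> V \<Longrightarrow> norm (\<G> x - \<G> y) \<le> KG * norm (x - y)"
    by (auto simp: lipschitz_on_def dist_norm)
  have LipG: "0 \<le> LipG" "\<And>x y. x \<in> V \<Longrightarrow> y \<in> V \<Longrightarrow> norm (\<G> x - \<G> y) \<le> LipG * norm (x - y)"
    unfolding LipG_def using lip_const_nonneg_and_bound[of KG V norm \<G> norm, OF KG] by auto

  obtain Kh where Kh: "0 \<le> Kh"
    "\<And>a b. a \<in> Pc ` V \<Longrightarrow> b \<in> Pc ` V \<Longrightarrow> n\<alpha> (h a - h b) \<le> Kh * n\<alpha> (a - b)"
    using h_lipschitz_on_bounded[OF \<open>locally_lipschitz_in_norm n\<alpha> (low_modes e m) h\<close> V R] by blast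
  have "0 \<le> n\<alpha> (a - b)" if "a \<in> Pc ` V" "b \<in> Pc ` V" for a b
    using that by (auto intro!: n_nonneg X_closed)
  then have Liph: "0 \<le> Liph"
    "\<And>a b. a \<in> Pc ` V \<Longrightarrow> b \<in> Pc ` V \<Longrightarrow> n\<alpha> (h a - h b) \<le> Liph * n\<alpha> (a - b)"
    unfolding Liph_def using lip_const_nonneg_and_bound[of Kh "Pc ` V" n\<alpha> h n\<alpha>, OF Kh] by auto

  \<comment> \<open>Admissible pairs and optimality\<close>
  have feasible: "ystar \<in> L2 T" "ustar \<in> L2 T" "sol T y0 ustar ystar"
    using \<open>is_arg_min (\<lambda>(y, u). J y u)
      (\<lambda>(y, u). y \<in> L2 T \<and> u \<in> L2 T \<and> sol T y0 u y) (ystar, ustar)\<close>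
    unfolding is_arg_min_def by auto
  have red_opt: "zR \<in> L2c" "uR \<in> L2c" "red uR zR"
    "\<And>z u. z \<in> L2c \<Longrightarrow> u \<in> L2c \<Longrightarrow> red u z \<Longrightarrow> JR zR uR \<le> JR z u"
    using \<open>is_arg_min (\<lambda>(z, u). JR z u)
      (\<lambda>(z, u). z \<in> L2c \<and> u \<in> L2c \<and> red u z) (zR, uR)\<close>
    unfolding is_arg_min_def by (auto simp: not_less)
  note solR = \<open>sol T y0 uR yR\<close>[unfolded sol_def] and solS = feasible(3)[unfolded sol_def]
  note redR = red_opt(3)[unfolded red_def] and redS = \<open>red ?u zstar\<close>[unfolded red_def]

  have cont: "continuous_on {0..T} yR" "continuous_on {0..T} ystar"
    "continuous_on {0..T} zR" "continuous_on {0..T} zstar"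
    using solR solS redR redS unfolding solves_controlled_def solves_reduced_def by auto
  have zH: "zR ` {0..T} \<subseteq> Hc" "zstar ` {0..T} \<subseteq> Hc"
    using redR redS unfolding solves_reduced_def by auto
  have L2_in: "yR \<in> L2_in H\<alpha> n\<alpha> T" "ystar \<in> L2_in H\<alpha> n\<alpha> T"
    using solR solS unfolding solves_controlled_def by auto
  have meas_u: "uR \<in> borel_measurable ?M" "ustar \<in> borel_measurable ?M"
    using red_opt(2) feasible(2) by (auto simp: L2c_def L2_def)
  have meas_Pu: "?u \<in> borel_measurable ?M"
    using measurable_compose[OF meas_u(2) borel_measurable_continuous_onI[OF
        linear_continuous_on[OF Pc_bounded_linear]]] .
  have int_u: "integrable ?M (\<lambda>t. (norm (ustar t))\<^sup>2)"
    using feasible(2) by (simp add: L2_def)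
  have int_Pu: "integrable ?M (\<lambda>t. (norm (?u t))\<^sup>2)"
    using meas_Pu by (intro Bochner_Integration.integrable_bound[OF int_u])
      (auto intro!: AE_I2 power_mono norm_Pc_le)
  have int_Qu: "integrable ?M (\<lambda>t. (norm (?u t - ustar t))\<^sup>2)"
  proof (rule Bochner_Integration.integrable_bound)
    show "integrable ?M (\<lambda>t. 2 * (norm (?u t))\<^sup>2 + 2 * (norm (ustar t))\<^sup>2)"
      using int_u int_Pu by simp
    show "(\<lambda>t. (norm (?u t - ustar t))\<^sup>2) \<in> borel_measurable ?M"
      using meas_u(2) meas_Pu by measurable
    have "(norm (a - b))\<^sup>2 \<le> 2 * (norm a)\<^sup>2 + 2 * (norm b)\<^sup>2" for a b :: 'a
    proof -
      have "(norm (a - b))\<^sup>2 \<le> (norm a + norm b)\<^sup>2"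
        by (intro power_mono norm_triangle_ineq4) simp
      then show ?thesis
        using sum_squares_bound[of "norm a" "norm b"] by (simp add: power2_sum)
    qed
    then show "AE t in ?M. norm ((norm (?u t - ustar t))\<^sup>2) \<le>
        norm (2 * (norm (?u t))\<^sup>2 + 2 * (norm (ustar t))\<^sup>2)"
      by (intro AE_I2) simp
  qed
  have "zstar \<in> L2c"
    unfolding L2c_def L2_def using zH(2) cont(4)
    by (auto intro!: AE_I2 continuous_imp_measurable_on_sets_lebesgue continuous_imp_integrable_real
        continuous_intros)
  moreover have "?u \<in> L2c"
    using meas_Pu int_Pu by (simp add: L2c_def L2_def)
  ultimately have JR_le: "JR zR uR \<le> JR zstar ?u"
    using \<open>red ?u zstar\<close> by (intro red_opt(4))

  \<comment> \<open>The two trajectory gaps\<close>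
  define k where "k = 1 + \<beta> 1 + C1 * CV * (1 + Liph)"
  define c where "c = 1 + C1 * C\<alpha> * Liph"
  define a where "a = max CV 1 * T * c * exp (k * T)"
  define \<delta> where "\<delta> y = sqrt (LINT t|?M. (defect (y t))\<^sup>2)" for y
  define \<eta> where "\<eta> = norm \<CC> * L2_norm norm T (\<lambda>t. ?u t - ustar t)"
  have k0: "0 \<le> k"
    unfolding k_def by fact
  have B: "norm (B v v - B w w) \<le> CB * (n\<alpha> v + n\<alpha> w) * n\<alpha> (v - w)" if "v \<in> H\<alpha>" "w \<in> H\<alpha>" for v w
    using \<open>\<forall>v\<in>H\<alpha>. \<forall>w\<in>H\<alpha>. norm (B v v - B w w) \<le> CB * (n\<alpha> v + n\<alpha> w) * n\<alpha> (v - w)\<close> that by blast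
  have CV: "CB * (n\<alpha> (yR t) + n\<alpha> (zR t + h (zR t))) \<le> CV"
    "CB * (n\<alpha> (ystar t) + n\<alpha> (zstar t + h (zstar t))) \<le> CV" if "t \<in> {0..T}" for t
    using \<open>\<forall>t\<in>{0..T}. CB * (n\<alpha> (yR t) + n\<alpha> (zR t + h (zR t))) \<le> CV \<and>
      CB * (n\<alpha> (ystar t) + n\<alpha> (zstar t + h (zstar t))) \<le> CV\<close> that by blast+
  have CV0: "0 \<le> CV"
    using \<open>CV > 0\<close> by simp

  \<comment> \<open>The same control drives both trajectories of the first gap, so its control
    mismatch vanishes.\<close>
  have int_0: "integrable ?M (\<lambda>t. (norm (uR t - uR t))\<^sup>2)" and norm_0: "L2_norm norm T (\<lambda>t. uR t - uR t) = 0"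
    by (simp_all add: L2_norm_def)
  note gap_R = integrated_gap[OF T solR redR V inV(1) inV(2) Liph B CV0 CV(1) k_def k0
    defect_integrable[OF L2_in(1) inV(1) V R Liph] defect_square_integrable[OF L2_in(1) inV(1) V R Liph]
    int_0, unfolded norm_0 mult_zero_right add_0_right, folded c_def, folded a_def \<delta>_def]
  obtain rR where rR: "integrable ?M rR"
    "\<And>t. t \<in> {0..T} \<Longrightarrow> norm (zR t + h (zR t) - yR t) \<le> rR t"
    "(LINT t|?M. rR t) \<le> C\<alpha> * sqrt T * \<delta> yR + a * \<delta> yR"
    by (rule gap_R) (auto intro: that)
  note gap_S = integrated_gap[OF T solS redS V inV(3) inV(4) Liph B CV0 CV(2) k_def k0
    defect_integrable[OF L2_in(2) inV(3) V R Liph] defect_square_integrable[OF L2_in(2) inV(3) V R Liph]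
    int_Qu, folded c_def, folded a_def \<delta>_def \<eta>_def]
  obtain rS where rS: "integrable ?M rS"
    "\<And>t. t \<in> {0..T} \<Longrightarrow> norm (zstar t + h (zstar t) - ystar t) \<le> rS t"
    "(LINT t|?M. rS t) \<le> C\<alpha> * sqrt T * \<delta> ystar + a * (\<delta> ystar + \<eta>)"
    by (rule gap_S) (auto intro: that)

  \<comment> \<open>Comparison of the costs\<close>
  have meas_sum: "(\<lambda>t. \<G> (x t) + \<E> (u t)) \<in> borel_measurable ?M"
    if "continuous_on {0..T} x" "u \<in> borel_measurable ?M" for x u
  proof -
    have "continuous_on {0..T} (\<lambda>t. \<G> (x t))"
      using \<open>continuous_on UNIV \<G>\<close> that(1) by (rule continuous_on_compose2) simp
    then have "(\<lambda>t. \<G> (x t)) \<in> borel_measurable ?M"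
      by (rule continuous_imp_measurable_on_sets_lebesgue) simp
    moreover have "(\<lambda>t. \<E> (u t)) \<in> borel_measurable ?M"
      using measurable_compose[OF that(2) borel_measurable_continuous_onI[OF \<open>continuous_on UNIV \<E>\<close>]] .
    ultimately show ?thesis
      by (rule borel_measurable_add)
  qed
  have r0: "0 \<le> LipG * rR t" "0 \<le> LipG * rS t" if "t \<in> {0..T}" for t
    using LipG(1) order_trans[OF norm_ge_zero rR(2)[OF that]] order_trans[OF norm_ge_zero rS(2)[OF that]]
    by simp_all
  have G_le: "\<G> x \<le> \<G> y + LipG * r" if "x \<in> V" "y \<in> V" "norm (x - y) \<le> r" for x y r
    using LipG(2)[OF that(1,2)] mult_left_mono[OF that(3) LipG(1)] by (simp add: abs_le_iff)
  have gapR: "J yR uR \<le> JR zR uR + ennreal (LINT t|?M. LipG * rR t)"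
    unfolding J_def JR_def
  proof (rule cost_le_cost_plus)
    show "(\<lambda>t. \<G> (zR t + h (zR t)) + \<E> (uR t)) \<in> borel_measurable ?M"
      using cont(3) zH(1) meas_u(1)
      by (intro meas_sum continuous_on_add continuous_on_compose2[OF h_continuous_on])
    show "\<G> (yR t) \<le> \<G> (zR t + h (zR t)) + LipG * rR t" if "t \<in> {0..T}" for t
      using inV[OF that] rR(2)[OF that] by (intro G_le) (auto simp: norm_minus_commute)
  qed (use \<open>\<forall>x. 0 \<le> \<G> x\<close> \<open>\<forall>x. 0 \<le> \<E> x\<close> rR(1) r0 in auto)
  have gapS: "JR zstar ?u \<le> J ystar ustar + ennreal (LINT t|?M. LipG * rS t)"
    unfolding J_def JR_def
  proof (rule cost_le_cost_plus)
    show "(\<lambda>t. \<G> (ystar t) + \<E> (ustar t)) \<in> borel_measurable ?M"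
      using cont(2) meas_u(2) by (rule meas_sum)
    show "\<G> (zstar t + h (zstar t)) \<le> \<G> (ystar t) + LipG * rS t" if "t \<in> {0..T}" for t
      using inV[OF that] rS(2)[OF that] by (intro G_le)
    show "\<E> (?u t) \<le> \<E> (ustar t)" for t
      using \<open>\<forall>u v. norm u \<le> norm v \<longrightarrow> \<E> u \<le> \<E> v\<close> norm_Pc_le by blast
  qed (use \<open>\<forall>x. 0 \<le> \<G> x\<close> \<open>\<forall>x. 0 \<le> \<E> x\<close> rS(1) r0 in auto)

  \<comment> \<open>Assembling the estimate\<close>
  let ?N = "(L2_norm norm T (uR - ustar))\<^sup>2"
  let ?IR = "LINT t|?M. LipG * rR t" and ?IS = "LINT t|?M. LipG * rS t"
  have I0: "0 \<le> ?IR" "0 \<le> ?IS"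
    by (intro Bochner_Integration.integral_nonneg r0, simp)+
  have "J ystar ustar + ennreal (\<sigma> * ?N) \<le> J yR uR"
    using \<open>\<forall>v\<in>\<U>. \<forall>y. sol T y0 v y \<longrightarrow>
      J y v \<ge> J ystar ustar + ennreal (\<sigma> * (L2_norm norm T (v - ustar))\<^sup>2)\<close>
      \<open>uR \<in> \<U>\<close> \<open>sol T y0 uR yR\<close> by blast
  also have "\<dots> \<le> JR zstar ?u + ennreal ?IR"
    using gapR JR_le by (meson add_right_mono order_trans)
  also have "\<dots> \<le> (J ystar ustar + ennreal ?IS) + ennreal ?IR"
    using gapS by (rule add_right_mono)
  also have "\<dots> = J ystar ustar + ennreal (?IS + ?IR)"
    using I0 by (simp add: add.assoc)
  \<comment> \<open>Cancelling the optimal cost in the extended reals is legitimate because it is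
    finite.\<close>
  finally have "ennreal (\<sigma> * ?N) \<le> ennreal (?IS + ?IR)"
    using \<open>J ystar ustar < \<infinity>\<close> by (auto simp: ennreal_add_left_cancel_le)
  then have "\<sigma> * ?N \<le> ?IS + ?IR"
    by (subst (asm) ennreal_le_iff) (use I0 in linarith)
  also have "\<dots> = LipG * ((LINT t|?M. rS t) + (LINT t|?M. rR t))"
    by (simp add: distrib_left)
  also have "\<dots> \<le> LipG * ((C\<alpha> * sqrt T + a) * (\<delta> yR + \<delta> ystar + \<eta>))"
  proof (intro mult_left_mono LipG(1))
    \<comment> \<open>The factor \<open>C\<alpha> * sqrt T\<close> comes with the defects only;
      adding this term lets one common factor multiply all three quantities.\<close>
    have "0 \<le> C\<alpha> * sqrt T * \<eta>"
      using C\<alpha>(1) T by (simp add: \<eta>_def L2_norm_def)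
    then show "(LINT t|?M. rS t) + (LINT t|?M. rR t) \<le> (C\<alpha> * sqrt T + a) * (\<delta> yR + \<delta> ystar + \<eta>)"
      using rS(3) rR(3) by (simp add: algebra_simps)
  qed
  also have "\<dots> \<le> 2 * (LipG * ((C\<alpha> * sqrt T + a) * (\<delta> yR + \<delta> ystar + \<eta>)))"
  proof -
    have "0 \<le> LipG * ((C\<alpha> * sqrt T + a) * (\<delta> yR + \<delta> ystar + \<eta>))"
      using LipG(1) Liph(1) C1(1) C\<alpha>(1) T
      by (simp add: \<delta>_def \<eta>_def a_def c_def L2_norm_def)
    then show ?thesis by simp
  qed
  finally have main: "\<sigma> * ?N \<le> 2 * (LipG * ((C\<alpha> * sqrt T + a) * (\<delta> yR + \<delta> ystar + \<eta>)))" .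

  have yX: "yR t \<in> H\<alpha>" "ystar t \<in> H\<alpha>" if "t \<in> {0..T}" for t
    using inV[OF that] V by auto
  have \<delta>R: "sqrt (param_defect n\<alpha> e m h T yR) * L2_norm n\<alpha> T (\<lambda>t. P_high e m (yR t)) = \<delta> yR"
    unfolding \<delta>_def
    by (rule sqrt_param_defect_mult[OF T cont(1) yX(1) Ps_square_integrable[OF L2_in(1) inV(1) V R Liph]])
      (use \<open>\<exists>t\<in>{0..T}. P_high e m (yR t) \<noteq> 0\<close> in auto)
  have \<delta>S: "sqrt (param_defect n\<alpha> e m h T ystar) * L2_norm n\<alpha> T (\<lambda>t. P_high e m (ystar t)) = \<delta> ystar"
    unfolding \<delta>_def
    by (rule sqrt_param_defect_mult[OF T cont(2) yX(2) Ps_square_integrable[OF L2_in(2) inV(3) V R Liph]])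
      (use \<open>\<exists>t\<in>{0..T}. P_high e m (ystar t) \<noteq> 0\<close> in auto)
  \<comment> \<open>The control mismatch of the second gap is minus the high-mode part of
    \<open>ustar\<close>.\<close>
  have \<eta>: "norm \<CC> * L2_norm norm T (\<lambda>t. P_high e m (ustar t)) = \<eta>"
    by (simp add: \<eta>_def L2_norm_def P_high_def norm_minus_commute)
  show ?thesis
    unfolding \<delta>R \<delta>S \<eta> using main \<open>\<sigma> > 0\<close>
    unfolding a_def c_def k_def by (simp add: field_simps)
qed

end
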